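(* Let $R$ be an artinian ring and let $\mathcal{S}$ be a full subcategory of $\operatorname{Mod} R$ (the category of right $R$-modules) which is closed under (arbitrary) direct sums and under submodules, and with $R_R\in\mathcal{S}$. Suppose that, up to isomorphism, there are only finitely many indecomposable objects of finite length in $\mathcal{S}$. Then every object of $\mathcal{S}$ is a direct sum of finitely generated indecomposable submodules. In particular, every indecomposable module in $\mathcal{S}$ has finite length. *)

theory Defs
  imports "HOL-Algebra.Module"
begin

text \<open>Right modules over a (not necessarily commutative) ring R.
  We reuse the HOL-Algebra record type of modules; the field smult is read
  as the right action: the element x times r is written r \<odot> x.\<close>

definition right_module :: "('r, 'c) ring_scheme \<Rightarrow> ('r, 'a, 'd) module_scheme \<Rightarrow> bool" where
  "right_module R M \<longleftrightarrow> ring R \<and> abelian_group M \<and>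
     (\<forall>r\<in>carrier R. \<forall>x\<in>carrier M. r \<odot>\<^bsub>M\<^esub> x \<in> carrier M) \<and>
     (\<forall>r\<in>carrier R. \<forall>x\<in>carrier M. \<forall>y\<in>carrier M.
        r \<odot>\<^bsub>M\<^esub> (x \<oplus>\<^bsub>M\<^esub> y) = (r \<odot>\<^bsub>M\<^esub> x) \<oplus>\<^bsub>M\<^esub> (r \<odot>\<^bsub>M\<^esub> y)) \<and>
     (\<forall>r\<in>carrier R. \<forall>s\<in>carrier R. \<forall>x\<in>carrier M.
        (r \<oplus>\<^bsub>R\<^esub> s) \<odot>\<^bsub>M\<^esub> x = (r \<odot>\<^bsub>M\<^esub> x) \<oplus>\<^bsub>M\<^esub> (s \<odot>\<^bsub>M\<^esub> x)) \<and>
     (\<forall>r\<in>carrier R. \<forall>s\<in>carrier R. \<forall>x\<in>carrier M.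
        s \<odot>\<^bsub>M\<^esub> (r \<odot>\<^bsub>M\<^esub> x) = (r \<otimes>\<^bsub>R\<^esub> s) \<odot>\<^bsub>M\<^esub> x) \<and>
     (\<forall>x\<in>carrier M. \<one>\<^bsub>R\<^esub> \<odot>\<^bsub>M\<^esub> x = x)"

definition regular_module :: "('r, 'c) ring_scheme \<Rightarrow> ('r, 'r) module" where
  "regular_module R = \<lparr>carrier = carrier R, monoid.mult = monoid.mult R, one = one R,
      zero = zero R, add = add R, smult = (\<lambda>r x. x \<otimes>\<^bsub>R\<^esub> r)\<rparr>"

definition submod :: "('r, 'c) ring_scheme \<Rightarrow> ('r, 'a, 'd) module_scheme \<Rightarrow> 'a set \<Rightarrow> bool" where
  "submod R M N \<longleftrightarrow> N \<subseteq> carrier M \<and> \<zero>\<^bsub>M\<^esub> \<in> N \<and>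
     (\<forall>x\<in>N. \<forall>y\<in>N. x \<oplus>\<^bsub>M\<^esub> y \<in> N) \<and> (\<forall>x\<in>N. \<ominus>\<^bsub>M\<^esub> x \<in> N) \<and>
     (\<forall>r\<in>carrier R. \<forall>x\<in>N. r \<odot>\<^bsub>M\<^esub> x \<in> N)"

definition mod_iso :: "('r, 'c) ring_scheme \<Rightarrow> ('r, 'a, 'd) module_scheme \<Rightarrow> ('r, 'b, 'e) module_scheme \<Rightarrow> bool" where
  "mod_iso R M M' \<longleftrightarrow> (\<exists>f. bij_betw f (carrier M) (carrier M') \<and>
     (\<forall>x\<in>carrier M. \<forall>y\<in>carrier M. f (x \<oplus>\<^bsub>M\<^esub> y) = f x \<oplus>\<^bsub>M'\<^esub> f y) \<and>
     (\<forall>r\<in>carrier R. \<forall>x\<in>carrier M. f (r \<odot>\<^bsub>M\<^esub> x) = r \<odot>\<^bsub>M'\<^esub> f x))"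

definition artinian_module :: "('r, 'c) ring_scheme \<Rightarrow> ('r, 'a, 'd) module_scheme \<Rightarrow> bool" where
  "artinian_module R M \<longleftrightarrow>
     (\<nexists>f :: nat \<Rightarrow> 'a set. (\<forall>n. submod R M (f n)) \<and> (\<forall>n. f (Suc n) \<subset> f n))"

definition right_artinian_ring :: "('r, 'c) ring_scheme \<Rightarrow> bool" where
  "right_artinian_ring R \<longleftrightarrow> ring R \<and> artinian_module R (regular_module R)"

definition finite_length :: "('r, 'c) ring_scheme \<Rightarrow> ('r, 'a, 'd) module_scheme \<Rightarrow> bool" where
  "finite_length R M \<longleftrightarrow> (\<exists>n::nat. \<forall>k (c :: nat \<Rightarrow> 'a set).
     (\<forall>i\<le>k. submod R M (c i)) \<and> (\<forall>i<k. c i \<subset> c (Suc i)) \<longrightarrow> k \<le> n)"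

definition indecomposable :: "('r, 'c) ring_scheme \<Rightarrow> ('r, 'a, 'd) module_scheme \<Rightarrow> bool" where
  "indecomposable R M \<longleftrightarrow> carrier M \<noteq> {\<zero>\<^bsub>M\<^esub>} \<and>
     (\<forall>A B. submod R M A \<and> submod R M B \<and> A \<inter> B = {\<zero>\<^bsub>M\<^esub>} \<and>
        carrier M = {a \<oplus>\<^bsub>M\<^esub> b | a b. a \<in> A \<and> b \<in> B}
        \<longrightarrow> A = {\<zero>\<^bsub>M\<^esub>} \<or> B = {\<zero>\<^bsub>M\<^esub>})"

definition fin_gen :: "('r, 'c) ring_scheme \<Rightarrow> ('r, 'a, 'd) module_scheme \<Rightarrow> bool" where
  "fin_gen R M \<longleftrightarrow> (\<exists>X. finite X \<and> X \<subseteq> carrier M \<and>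
     (\<forall>N. submod R M N \<and> X \<subseteq> N \<longrightarrow> carrier M \<subseteq> N))"

definition internal_dsum :: "('r, 'c) ring_scheme \<Rightarrow> ('r, 'a, 'd) module_scheme \<Rightarrow> 'a set set \<Rightarrow> bool" where
  "internal_dsum R M \<N> \<longleftrightarrow> (\<forall>N\<in>\<N>. submod R M N) \<and>
     (\<forall>x\<in>carrier M. \<exists>F g. finite F \<and> F \<subseteq> \<N> \<and> (\<forall>N\<in>F. g N \<in> N) \<and> x = finsum M g F) \<and>
     (\<forall>F g. finite F \<and> F \<subseteq> \<N> \<and> (\<forall>N\<in>F. g N \<in> N) \<and> finsum M g F = \<zero>\<^bsub>M\<^esub>
        \<longrightarrow> (\<forall>N\<in>F. g N = \<zero>\<^bsub>M\<^esub>))"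

text \<open>Full subcategory S (a class of right R-modules carried by the universe type 'a,
  closed under isomorphism) with the closure properties of the theorem.\<close>
definition good_subcat :: "('r, 'c) ring_scheme \<Rightarrow> ('r, 'a) module set \<Rightarrow> bool" where
  "good_subcat R S \<longleftrightarrow>
     (\<forall>M\<in>S. right_module R M) \<and>
     (\<forall>M M'. M \<in> S \<and> right_module R M' \<and> mod_iso R M M' \<longrightarrow> M' \<in> S) \<and>
     (\<forall>M N. M \<in> S \<and> submod R M N \<longrightarrow> M\<lparr>carrier := N\<rparr> \<in> S) \<and>
     (\<forall>M. right_module R M \<and>
        (\<exists>\<N>. internal_dsum R M \<N> \<and> (\<forall>N\<in>\<N>. M\<lparr>carrier := N\<rparr> \<in> S)) \<longrightarrow> M \<in> S)"

end

theory Submission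
  imports Defs
begin

text \<open>All the work takes place inside a module \<open>M\<close> each of whose elements lies in a submodule of
  finite length, under the assumption that the indecomposable submodules of finite length have
  bounded length. The argument is Bass's theorem (flat modules over a perfect ring are projective),
  unwound for the functor \<open>Hom(-, M)\<close> on these submodules. Call a map \<open>W \<rightarrow> M\<close> radical if it is a sum
  of non-isomorphisms \<open>W \<rightarrow> V \<subseteq> M\<close>, with \<open>V\<close> and \<open>W\<close> indecomposable of finite length, and take a
  maximal family \<open>B\<close> of such submodules whose inclusions are independent modulo radical maps.
  By maximality every inclusion \<open>W \<rightarrow> M\<close> is a combination of members of \<open>B\<close> modulo radical maps,
  and since long composites of non-isomorphisms vanish (Harada and Sai), the radical part can be
  removed; hence \<open>B\<close> spans \<open>M\<close>. If \<open>p\<^sub>1 + \<dots> + p\<^sub>n = 0\<close> with \<open>p\<^sub>i \<in> V\<^sub>i \<in> B\<close>, then writing the inclusion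
  of \<open>V\<^sub>1 + \<dots> + V\<^sub>n\<close> through \<open>B\<close> produces a matrix \<open>\<kappa>\<close> of non-isomorphisms with \<open>p = -\<kappa> p\<close>, so \<open>p = 0\<close>,
  again by Harada and Sai.

  In the theorem, finitely many isomorphism types give the length bound. Every element of a module
  in the subcategory lies in a submodule of finite length because the regular module has finite
  length: its largest submodule that is a union of submodules of finite length decomposes by the
  above, is artinian, hence is a finite sum and has finite length; a minimal submodule strictly
  above it would have finite length as well.\<close>

subsection \<open>Chains and length\<close>

definition strict_chain :: "'a set set \<Rightarrow> nat \<Rightarrow> (nat \<Rightarrow> 'a set) \<Rightarrow> bool" where
  "strict_chain C k c \<longleftrightarrow> (\<forall>i\<le>k. c i \<in> C) \<and> (\<forall>i<k. c i \<subset> c (Suc i))"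

text \<open>The index \<open>k\<close> counts strict inclusions. The family \<open>C\<close> is
  arbitrary so that the same notion covers the submodules of a given submodule and the interval
  between two submodules.\<close>

definition chain_bounded :: "'a set set \<Rightarrow> nat \<Rightarrow> bool" where
  "chain_bounded C n \<longleftrightarrow> (\<forall>k c. strict_chain C k c \<longrightarrow> k \<le> n)"

text \<open>Meaningful only if the chains in \<open>C\<close> have bounded length.\<close>
definition height :: "'a set set \<Rightarrow> 'a set \<Rightarrow> nat" where
  "height C X = Max {k. \<exists>c. strict_chain C k c \<and> c k = X}"

lemma strict_chain_mono: "strict_chain C k c \<Longrightarrow> i \<le> j \<Longrightarrow> j \<le> k \<Longrightarrow> c i \<subseteq> c j"
proof (induction j)
  case (Suc j)
  have "c j \<subseteq> c (Suc j)" using Suc.prems unfolding strict_chain_def by (meson Suc_le_lessD psubsetE)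
  then show ?case using Suc by (cases "i = Suc j") auto
qed simp

lemma chain_bounded_subset: "chain_bounded C n \<Longrightarrow> C' \<subseteq> C \<Longrightarrow> chain_bounded C' n"
  unfolding chain_bounded_def strict_chain_def by blast

text \<open>The rank rises by at least one at each strict inclusion, so the last term of a chain
  with \<open>k\<close> inclusions has rank at least \<open>k\<close>.\<close>

lemma chain_bounded_rank:
  assumes "\<And>X. X \<in> C \<Longrightarrow> \<rho> X \<le> n" and "\<And>X Y. X \<in> C \<Longrightarrow> Y \<in> C \<Longrightarrow> X \<subset> Y \<Longrightarrow> \<rho> X < \<rho> Y"
  shows "chain_bounded C n"
  unfolding chain_bounded_def
proof (intro allI impI)
  fix k c assume sc: "strict_chain C k c"
  have "i \<le> k \<Longrightarrow> i \<le> \<rho> (c i)" for i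
  proof (induction i)
    case (Suc i)
    have "\<rho> (c i) < \<rho> (c (Suc i))"
      using Suc.prems sc by (intro assms(2)) (auto simp: strict_chain_def)
    then show ?case using Suc by simp
  qed simp
  then show "k \<le> n" using assms(1)[of "c k"] sc unfolding strict_chain_def by (meson le_trans order_refl)
qed

lemma chain_bounded_strict_map:
  assumes "chain_bounded C n" and "\<And>X. X \<in> C' \<Longrightarrow> \<phi> X \<in> C"
    and "\<And>X Y. X \<in> C' \<Longrightarrow> Y \<in> C' \<Longrightarrow> X \<subset> Y \<Longrightarrow> \<phi> X \<subset> \<phi> Y"
  shows "chain_bounded C' n"
  unfolding chain_bounded_def
proof (intro allI impI)
  fix k c assume "strict_chain C' k c"
  then have "strict_chain C k (\<lambda>i. \<phi> (c i))"
    using assms(2,3) by (simp add: strict_chain_def)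
  then show "k \<le> n" using assms(1) by (auto simp: chain_bounded_def)
qed

lemma height_set:
  assumes "chain_bounded C n"
  shows "finite {k. \<exists>c. strict_chain C k c \<and> c k = X}"
  by (rule finite_subset[of _ "{..n}"]) (use assms in \<open>auto simp: chain_bounded_def\<close>)

lemma height_ge: "chain_bounded C n \<Longrightarrow> strict_chain C k c \<Longrightarrow> c k = X \<Longrightarrow> k \<le> height C X"
  unfolding height_def by (rule Max_ge[OF height_set]) auto

lemma height_attained:
  assumes "chain_bounded C n" "X \<in> C"
  obtains c where "strict_chain C (height C X) c" "c (height C X) = X"
proof -
  have "0 \<in> {k. \<exists>c. strict_chain C k c \<and> c k = X}"
    using assms(2) by (auto simp: strict_chain_def intro!: exI[of _ "\<lambda>_. X"])
  then have "height C X \<in> {k. \<exists>c. strict_chain C k c \<and> c k = X}"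
    unfolding height_def using Max_in[OF height_set[OF assms(1)]] by blast
  then show ?thesis using that by blast
qed

lemma height_le: "chain_bounded C n \<Longrightarrow> X \<in> C \<Longrightarrow> height C X \<le> n"
  by (metis chain_bounded_def height_attained)

lemma strict_chain_snoc:
  assumes "strict_chain C k c" "c k \<subset> Y" "Y \<in> C"
  shows "strict_chain C (Suc k) (\<lambda>i. if i \<le> k then c i else Y)"
  using assms by (auto simp: strict_chain_def le_Suc_eq less_Suc_eq)

lemma height_less:
  assumes "chain_bounded C n" "X \<in> C" "Y \<in> C" "X \<subset> Y"
  shows "height C X < height C Y"
proof -
  obtain c where c: "strict_chain C (height C X) c" "c (height C X) = X"
    using height_attained[OF assms(1,2)] .
  have "Suc (height C X) \<le> height C Y"
    using c assms(3,4)
    by (intro height_ge[OF assms(1) strict_chain_snoc[OF c(1)]]) auto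
  then show ?thesis by simp
qed

lemma height_mono:
  assumes "chain_bounded C n" "X \<in> C" "Y \<in> C" "X \<subseteq> Y"
  shows "height C X \<le> height C Y"
  using height_less[OF assms(1-3)] assms(4) by (metis less_imp_le order_refl psubsetI)

section \<open>Finite length, and linear maps between subsets of modules\<close>

definition submods :: "('r, 'c) ring_scheme \<Rightarrow> ('r, 'a, 'd) module_scheme \<Rightarrow> 'a set \<Rightarrow> 'a set set" where
  "submods R M X = {A. submod R M A \<and> A \<subseteq> X}"

definition fl :: "('r, 'c) ring_scheme \<Rightarrow> ('r, 'a, 'd) module_scheme \<Rightarrow> 'a set \<Rightarrow> bool" where
  "fl R M X \<longleftrightarrow> (\<exists>n. chain_bounded (submods R M X) n)"

definition len :: "('r, 'c) ring_scheme \<Rightarrow> ('r, 'a, 'd) module_scheme \<Rightarrow> 'a set \<Rightarrow> nat" where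
  "len R M X = height (submods R M X) X"

text \<open>Source and target are subsets of the carriers, so maps between submodules need no change
  of the module record.\<close>

definition lin :: "('r, 'c) ring_scheme \<Rightarrow> ('r, 'a, 'd) module_scheme \<Rightarrow> ('r, 'b, 'e) module_scheme \<Rightarrow>
    'a set \<Rightarrow> 'b set \<Rightarrow> ('a \<Rightarrow> 'b) set" where
  "lin R M M' X Y = {f. f \<in> X \<rightarrow> Y \<and> (\<forall>x\<in>X. \<forall>y\<in>X. f (x \<oplus>\<^bsub>M\<^esub> y) = f x \<oplus>\<^bsub>M'\<^esub> f y) \<and>
     (\<forall>r\<in>carrier R. \<forall>x\<in>X. f (r \<odot>\<^bsub>M\<^esub> x) = r \<odot>\<^bsub>M'\<^esub> f x)}"

lemma linI:
  assumes "\<And>x. x \<in> X \<Longrightarrow> f x \<in> Y"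
    and "\<And>x y. x \<in> X \<Longrightarrow> y \<in> X \<Longrightarrow> f (x \<oplus>\<^bsub>M\<^esub> y) = f x \<oplus>\<^bsub>M'\<^esub> f y"
    and "\<And>r x. r \<in> carrier R \<Longrightarrow> x \<in> X \<Longrightarrow> f (r \<odot>\<^bsub>M\<^esub> x) = r \<odot>\<^bsub>M'\<^esub> f x"
  shows "f \<in> lin R M M' X Y"
  using assms by (auto simp: lin_def)

lemma lin_mem: "f \<in> lin R M M' X Y \<Longrightarrow> x \<in> X \<Longrightarrow> f x \<in> Y"
  and lin_add: "f \<in> lin R M M' X Y \<Longrightarrow> x \<in> X \<Longrightarrow> y \<in> X \<Longrightarrow> f (x \<oplus>\<^bsub>M\<^esub> y) = f x \<oplus>\<^bsub>M'\<^esub> f y"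
  and lin_smult: "f \<in> lin R M M' X Y \<Longrightarrow> r \<in> carrier R \<Longrightarrow> x \<in> X \<Longrightarrow> f (r \<odot>\<^bsub>M\<^esub> x) = r \<odot>\<^bsub>M'\<^esub> f x"
  by (auto simp: lin_def)

lemma lin_subset: "f \<in> lin R M M' X Y \<Longrightarrow> X' \<subseteq> X \<Longrightarrow> f ` X' \<subseteq> Y' \<Longrightarrow> f \<in> lin R M M' X' Y'"
  unfolding lin_def by blast

lemma lin_comp: "f \<in> lin R M M' X Y \<Longrightarrow> g \<in> lin R M' M'' Y Z \<Longrightarrow> g \<circ> f \<in> lin R M M'' X Z"
  unfolding lin_def by (auto simp: Pi_iff)

lemma submodD:
  assumes "submod R M N"
  shows "x \<in> N \<Longrightarrow> x \<in> carrier M" "\<zero>\<^bsub>M\<^esub> \<in> N" "x \<in> N \<Longrightarrow> y \<in> N \<Longrightarrow> x \<oplus>\<^bsub>M\<^esub> y \<in> N"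
    "x \<in> N \<Longrightarrow> \<ominus>\<^bsub>M\<^esub> x \<in> N" "r \<in> carrier R \<Longrightarrow> x \<in> N \<Longrightarrow> r \<odot>\<^bsub>M\<^esub> x \<in> N"
  using assms by (auto simp: submod_def)

lemma lin_inv:
  assumes f: "f \<in> lin R M M' X Y" and b: "bij_betw f X Y" and X: "submod R M X"
  shows "inv_into X f \<in> lin R M' M Y X"
proof (rule linI)
  let ?g = "inv_into X f"
  have g: "?g y \<in> X" "f (?g y) = y" if "y \<in> Y" for y
    using that b by (auto simp: bij_betw_def inv_into_into f_inv_into_f)
  have gf: "?g (f x) = x" if "x \<in> X" for x
    using that b by (simp add: bij_betw_def)
  show "?g x \<in> X" if "x \<in> Y" for x by (rule g(1)[OF that])
  show "?g (x \<oplus>\<^bsub>M'\<^esub> y) = ?g x \<oplus>\<^bsub>M\<^esub> ?g y" if "x \<in> Y" "y \<in> Y" for x y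
  proof -
    have "f (?g x \<oplus>\<^bsub>M\<^esub> ?g y) = x \<oplus>\<^bsub>M'\<^esub> y" using lin_add[OF f] g that by simp
    then show ?thesis using gf[of "?g x \<oplus>\<^bsub>M\<^esub> ?g y"] submodD(3)[OF X] g(1) that by simp
  qed
  show "?g (r \<odot>\<^bsub>M'\<^esub> x) = r \<odot>\<^bsub>M\<^esub> ?g x" if "r \<in> carrier R" "x \<in> Y" for r x
  proof -
    have "f (r \<odot>\<^bsub>M\<^esub> ?g x) = r \<odot>\<^bsub>M'\<^esub> x" using lin_smult[OF f] g that by simp
    then show ?thesis using gf[of "r \<odot>\<^bsub>M\<^esub> ?g x"] submodD(5)[OF X] g(1) that by simp
  qed
qed

lemma right_module_regular:
  assumes "ring R"
  shows "right_module R (regular_module R)"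
proof -
  interpret ring R by fact
  have "abelian_group (regular_module R)"
  proof (rule abelian_groupI)
    show "\<exists>y\<in>carrier (regular_module R). y \<oplus>\<^bsub>regular_module R\<^esub> x = \<zero>\<^bsub>regular_module R\<^esub>"
      if "x \<in> carrier (regular_module R)" for x
      using that l_neg[of x] a_inv_closed[of x] by (auto simp: regular_module_def)
  qed (auto simp: regular_module_def a_ac)
  then show ?thesis
    using assms by (auto simp: right_module_def regular_module_def l_distr r_distr m_assoc)
qed

section \<open>Submodules of a fixed right module\<close>

locale rmod = abelian_group M for R :: "('r, 'c) ring_scheme" and M :: "('r, 'a, 'd) module_scheme" (structure) +
  assumes right_module: "right_module R M"

lemma rmodI: "right_module R M \<Longrightarrow> rmod R M"
  by (simp add: rmod_def rmod_axioms_def right_module_def)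

context rmod begin

lemma smult_closed [simp, intro]: "r \<in> carrier R \<Longrightarrow> x \<in> carrier M \<Longrightarrow> r \<odot> x \<in> carrier M"
  and smult_add: "r \<in> carrier R \<Longrightarrow> x \<in> carrier M \<Longrightarrow> y \<in> carrier M \<Longrightarrow> r \<odot> (x \<oplus> y) = (r \<odot> x) \<oplus> (r \<odot> y)"
  and add_smult: "r \<in> carrier R \<Longrightarrow> s \<in> carrier R \<Longrightarrow> x \<in> carrier M \<Longrightarrow> (r \<oplus>\<^bsub>R\<^esub> s) \<odot> x = (r \<odot> x) \<oplus> (s \<odot> x)"
  and smult_assoc: "r \<in> carrier R \<Longrightarrow> s \<in> carrier R \<Longrightarrow> x \<in> carrier M \<Longrightarrow> s \<odot> (r \<odot> x) = (r \<otimes>\<^bsub>R\<^esub> s) \<odot> x"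
  and one_smult: "x \<in> carrier M \<Longrightarrow> \<one>\<^bsub>R\<^esub> \<odot> x = x"
  and ring_R: "ring R"
  using right_module by (auto simp: right_module_def)

lemma smult_zero: "r \<in> carrier R \<Longrightarrow> r \<odot> \<zero> = \<zero>"
  using smult_add[of r \<zero> \<zero>] by (metis add.l_cancel_one zero_closed smult_closed l_zero)

lemma smult_neg: "r \<in> carrier R \<Longrightarrow> x \<in> carrier M \<Longrightarrow> r \<odot> (\<ominus> x) = \<ominus> (r \<odot> x)"
  using smult_add[of r "\<ominus> x" x] minus_equality[of "r \<odot> (\<ominus> x)" "r \<odot> x"] by (simp add: l_neg smult_zero)

lemma lin_zero:
  assumes "f \<in> lin R M' M X Y" "submod R M' X" "rmod R M'" "Y \<subseteq> carrier M"
  shows "f \<zero>\<^bsub>M'\<^esub> = \<zero>"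
proof -
  interpret M': rmod R M' by fact
  have "f \<zero>\<^bsub>M'\<^esub> \<in> carrier M" by (rule subsetD[OF assms(4) lin_mem[OF assms(1) submodD(2)[OF assms(2)]]])
  moreover have "f \<zero>\<^bsub>M'\<^esub> \<oplus> f \<zero>\<^bsub>M'\<^esub> = f \<zero>\<^bsub>M'\<^esub>"
    using lin_add[OF assms(1) submodD(2)[OF assms(2)] submodD(2)[OF assms(2)]] by simp
  ultimately show ?thesis by simp
qed

lemma lin_neg:
  assumes "f \<in> lin R M' M X Y" "submod R M' X" "rmod R M'" "Y \<subseteq> carrier M" "x \<in> X"
  shows "f (\<ominus>\<^bsub>M'\<^esub> x) = \<ominus> f x"
proof -
  interpret M': rmod R M' by fact
  have x: "x \<in> carrier M'" "\<ominus>\<^bsub>M'\<^esub> x \<in> X" using assms submodD[OF assms(2)] by auto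
  have "f (\<ominus>\<^bsub>M'\<^esub> x) \<oplus> f x = \<zero>"
    using lin_add[OF assms(1) x(2) assms(5)] lin_zero[OF assms(1-4)] x by (simp add: M'.l_neg)
  then have "\<ominus> f x = f (\<ominus>\<^bsub>M'\<^esub> x)"
    using lin_mem[OF assms(1)] assms(4,5) x(2) by (intro minus_equality) auto
  then show ?thesis by simp
qed

lemma submod_zero: "submod R M {\<zero>}"
  by (auto simp: submod_def smult_zero)

lemma submod_carrier: "submod R M (carrier M)"
  by (auto simp: submod_def)

lemma submod_Int: "submod R M A \<Longrightarrow> submod R M B \<Longrightarrow> submod R M (A \<inter> B)"
  by (auto simp: submod_def)

definition plus :: "'a set \<Rightarrow> 'a set \<Rightarrow> 'a set" where
  "plus A B = {a \<oplus> b | a b. a \<in> A \<and> b \<in> B}"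

lemma plusI: "a \<in> A \<Longrightarrow> b \<in> B \<Longrightarrow> a \<oplus> b \<in> plus A B"
  by (auto simp: plus_def)

lemma plusE:
  assumes "x \<in> plus A B"
  obtains a b where "x = a \<oplus> b" "a \<in> A" "b \<in> B"
  using assms by (auto simp: plus_def)

lemma submod_plus:
  assumes A: "submod R M A" and B: "submod R M B"
  shows "submod R M (plus A B)"
  unfolding submod_def
proof (intro conjI ballI)
  note D = submodD(1)[OF A] submodD(1)[OF B]
  show "plus A B \<subseteq> carrier M" using D by (auto elim!: plusE)
  have "\<zero> \<oplus> \<zero> \<in> plus A B" by (rule plusI[OF submodD(2)[OF A] submodD(2)[OF B]])
  then show "\<zero> \<in> plus A B" by simp
  show "x \<oplus> y \<in> plus A B" if xy: "x \<in> plus A B" "y \<in> plus A B" for x y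
  proof -
    from xy obtain a b a' b' where *: "x = a \<oplus> b" "y = a' \<oplus> b'" "a \<in> A" "b \<in> B" "a' \<in> A" "b' \<in> B"
      by (elim plusE)
    then have "x \<oplus> y = (a \<oplus> a') \<oplus> (b \<oplus> b')" using D by (simp add: a_ac)
    then show ?thesis using * plusI[of "a \<oplus> a'" A "b \<oplus> b'" B] submodD(3)[OF A] submodD(3)[OF B] by simp
  qed
  show "\<ominus> x \<in> plus A B" if "x \<in> plus A B" for x
  proof -
    from that obtain a b where *: "x = a \<oplus> b" "a \<in> A" "b \<in> B" by (elim plusE)
    then have "\<ominus> x = \<ominus> a \<oplus> \<ominus> b" using D by (simp add: minus_add)
    then show ?thesis using * plusI[of "\<ominus> a" A "\<ominus> b" B] submodD(4)[OF A] submodD(4)[OF B] by simp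
  qed
  show "r \<odot> x \<in> plus A B" if r: "r \<in> carrier R" and "x \<in> plus A B" for r x
  proof -
    from that(2) obtain a b where *: "x = a \<oplus> b" "a \<in> A" "b \<in> B" by (elim plusE)
    then have "r \<odot> x = r \<odot> a \<oplus> r \<odot> b" using D r by (simp add: smult_add)
    then show ?thesis
      using * plusI[of "r \<odot> a" A "r \<odot> b" B] submodD(5)[OF A r] submodD(5)[OF B r] by simp
  qed
qed

lemma plus_upper:
  assumes A: "submod R M A" and B: "submod R M B"
  shows "A \<subseteq> plus A B" "B \<subseteq> plus A B"
proof -
  show "A \<subseteq> plus A B"
  proof
    fix x assume "x \<in> A"
    then show "x \<in> plus A B"
      using plusI[of x A \<zero> B] submodD(1)[OF A, of x] submodD(2)[OF B] by simp
  qed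
  show "B \<subseteq> plus A B"
  proof
    fix x assume "x \<in> B"
    then show "x \<in> plus A B"
      using plusI[of \<zero> A x B] submodD(1)[OF B, of x] submodD(2)[OF A] by simp
  qed
qed

lemma plus_least: "submod R M C \<Longrightarrow> A \<subseteq> C \<Longrightarrow> B \<subseteq> C \<Longrightarrow> plus A B \<subseteq> C"
  by (auto simp: plus_def dest: submodD(3))

text \<open>This is a consequence of the modular law: an element of \<open>C'\<close> has the form
  \<open>c\<close> plus \<open>a\<close> with \<open>c\<close> in \<open>C\<close> and
  \<open>a\<close> in \<open>A\<close>, and then \<open>a\<close> lies in \<open>C'\<close> together
  with \<open>c\<close>, hence in \<open>C\<close>.\<close>

lemma submod_eq_by_parts:
  assumes "submod R M C" "submod R M C'" "submod R M A" "C \<subseteq> C'"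
    and "C' \<inter> A \<subseteq> C \<inter> A" "plus C' A \<subseteq> plus C A"
  shows "C = C'"
proof
  show "C' \<subseteq> C"
  proof
    fix x assume x: "x \<in> C'"
    then have "x \<in> plus C A" using assms(6) plus_upper[OF assms(2,3)] by blast
    then obtain c a where ca: "x = c \<oplus> a" "c \<in> C" "a \<in> A" by (auto simp: plus_def)
    note D = submodD(1)[OF assms(1)] submodD(1)[OF assms(3)]
    have "a = \<ominus> c \<oplus> x" using ca D by (simp add: r_neg1)
    moreover have "\<ominus> c \<in> C'" using submodD(4)[OF assms(1)] ca assms(4) by blast
    ultimately have "a \<in> C'" using submodD(3)[OF assms(2)] x by simp
    then have "a \<in> C" using ca assms(5) by blast
    then show "x \<in> C" using ca submodD(3)[OF assms(1)] by simp
  qed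
qed (use assms in auto)

section \<open>Finite length under extensions, sums and images\<close>

lemma fl_subset:
  assumes "fl R M X" "Y \<subseteq> X"
  shows "fl R M Y"
proof -
  have "submods R M Y \<subseteq> submods R M X" using assms(2) by (auto simp: submods_def)
  then show ?thesis using assms(1) chain_bounded_subset unfolding fl_def by blast
qed

text \<open>The rank of \<open>C\<close> is the height of its trace on \<open>A\<close> plus the
  height of its sum with \<open>A\<close> in the interval from \<open>A\<close> to \<open>N\<close>.
  Both are monotone, and by \<open>submod_eq_by_parts\<close> a strict inclusion raises at least one
  of them.\<close>

lemma fl_extension:
  assumes A: "submod R M A" "fl R M A" and N: "submod R M N" "A \<subseteq> N"
    and ch: "chain_bounded {C. submod R M C \<and> A \<subseteq> C \<and> C \<subseteq> N} n"
  shows "fl R M N"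
proof -
  define I where "I = {C. submod R M C \<and> A \<subseteq> C \<and> C \<subseteq> N}"
  obtain m where m: "chain_bounded (submods R M A) m" using A unfolding fl_def by blast
  define \<rho> where "\<rho> C = height (submods R M A) (C \<inter> A) + height I (plus C A)" for C
  have mem: "C \<inter> A \<in> submods R M A" "plus C A \<in> I" if "C \<in> submods R M N" for C
  proof -
    have C: "submod R M C" "C \<subseteq> N" using that by (auto simp: submods_def)
    show "C \<inter> A \<in> submods R M A" using submod_Int[OF C(1) A(1)] by (simp add: submods_def)
    show "plus C A \<in> I"
      using submod_plus[OF C(1) A(1)] plus_upper(2)[OF C(1) A(1)] plus_least[OF N(1) C(2) N(2)]
      by (simp add: I_def)
  qed
  have ch': "chain_bounded I n" using ch unfolding I_def .
  have "chain_bounded (submods R M N) (m + n)"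
  proof (rule chain_bounded_rank)
    fix C assume C: "C \<in> submods R M N"
    show "\<rho> C \<le> m + n" unfolding \<rho>_def
      using height_le[OF m mem(1)[OF C]] height_le[OF ch' mem(2)[OF C]] by simp
  next
    fix C C' assume C: "C \<in> submods R M N" "C' \<in> submods R M N" "C \<subset> C'"
    have s: "C \<inter> A \<subseteq> C' \<inter> A" "plus C A \<subseteq> plus C' A"
      using C(3) by (auto simp: plus_def)
    have "C = C'" if "C \<inter> A = C' \<inter> A" "plus C A = plus C' A"
      by (rule submod_eq_by_parts[OF _ _ A(1)]) (use C that in \<open>auto simp: submods_def\<close>)
    then have "C \<inter> A \<noteq> C' \<inter> A \<or> plus C A \<noteq> plus C' A" using C(3) by blast
    then have "C \<inter> A \<subset> C' \<inter> A \<or> plus C A \<subset> plus C' A" using s by blast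
    moreover have "height (submods R M A) (C \<inter> A) \<le> height (submods R M A) (C' \<inter> A)"
      by (rule height_mono[OF m mem(1)[OF C(1)] mem(1)[OF C(2)] s(1)])
    moreover have "height I (plus C A) \<le> height I (plus C' A)"
      by (rule height_mono[OF ch' mem(2)[OF C(1)] mem(2)[OF C(2)] s(2)])
    ultimately show "\<rho> C < \<rho> C'"
      using height_less[OF m mem(1)[OF C(1)] mem(1)[OF C(2)]]
        height_less[OF ch' mem(2)[OF C(1)] mem(2)[OF C(2)]]
      unfolding \<rho>_def by (meson add_less_le_mono add_le_less_mono)
  qed
  then show ?thesis by (auto simp: fl_def)
qed

text \<open>As in the second isomorphism theorem, intersecting with \<open>B\<close> maps the
  interval from \<open>A\<close> to \<open>plus A B\<close> strictly monotonically into the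
  submodules of \<open>B\<close>: all members of the interval have the same sum with
  \<open>B\<close>.\<close>

lemma fl_plus:
  assumes A: "submod R M A" "fl R M A" and B: "submod R M B" "fl R M B"
  shows "fl R M (plus A B)"
proof -
  obtain n where n: "chain_bounded (submods R M B) n" using B unfolding fl_def by blast
  have "chain_bounded {C. submod R M C \<and> A \<subseteq> C \<and> C \<subseteq> plus A B} n"
  proof (rule chain_bounded_strict_map[OF n, of _ "\<lambda>C. C \<inter> B"])
    fix C C' assume C: "C \<in> {C. submod R M C \<and> A \<subseteq> C \<and> C \<subseteq> plus A B}"
      "C' \<in> {C. submod R M C \<and> A \<subseteq> C \<and> C \<subseteq> plus A B}" "C \<subset> C'"
    have "plus C' B \<subseteq> plus C B"
    proof (rule plus_least[OF submod_plus])
      have "plus A B \<subseteq> plus C B" using C(1) by (auto simp: plus_def)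
      then show "C' \<subseteq> plus C B" using C(2) by blast
      show "B \<subseteq> plus C B" using C(1) B(1) by (intro plus_upper) auto
    qed (use C B in auto)
    then have "C' \<inter> B \<subseteq> C \<inter> B \<Longrightarrow> C = C'"
      using C B by (intro submod_eq_by_parts[of C C' B]) auto
    then show "C \<inter> B \<subset> C' \<inter> B" using C(3) by blast
  qed (use B in \<open>auto simp: submods_def intro: submod_Int\<close>)
  then show ?thesis using fl_extension[of A "plus A B"] A B submod_plus plus_upper by blast
qed

lemma len_less: "fl R M B \<Longrightarrow> submod R M A \<Longrightarrow> submod R M B \<Longrightarrow> A \<subset> B \<Longrightarrow> len R M A < len R M B"
proof -
  assume h: "fl R M B" "submod R M A" "submod R M B" "A \<subset> B"
  obtain n where n: "chain_bounded (submods R M B) n" using h unfolding fl_def by blast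
  \<comment> \<open>Chains ending at \<open>A\<close> are the same in both families, so both heights
    of \<open>A\<close> agree and can be compared inside \<open>submods R M B\<close>.\<close>
  have "strict_chain (submods R M A) k c \<and> c k = A \<longleftrightarrow> strict_chain (submods R M B) k c \<and> c k = A" for k c
  proof
    assume "strict_chain (submods R M B) k c \<and> c k = A"
    then show "strict_chain (submods R M A) k c \<and> c k = A"
      using strict_chain_mono[of "submods R M B" k c _ k] by (auto simp: strict_chain_def submods_def)
  qed (use h in \<open>auto simp: strict_chain_def submods_def\<close>)
  then have "height (submods R M A) A = height (submods R M B) A"
    by (simp add: height_def)
  moreover have "height (submods R M B) A < height (submods R M B) B"
    by (rule height_less[OF n]) (use h in \<open>auto simp: submods_def\<close>)
  ultimately show ?thesis by (simp add: len_def)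
qed

lemma len_le: "fl R M B \<Longrightarrow> submod R M A \<Longrightarrow> submod R M B \<Longrightarrow> A \<subseteq> B \<Longrightarrow> len R M A \<le> len R M B"
  by (metis len_less less_imp_le order_refl psubsetI)

lemma len_eq: "fl R M B \<Longrightarrow> submod R M A \<Longrightarrow> submod R M B \<Longrightarrow> A \<subseteq> B \<Longrightarrow> len R M B \<le> len R M A \<Longrightarrow> A = B"
  by (metis len_less not_less psubsetI)

lemma len_zero_iff: "fl R M A \<Longrightarrow> submod R M A \<Longrightarrow> len R M A = 0 \<Longrightarrow> A = {\<zero>}"
  using len_eq[of A "{\<zero>}"] submod_zero submodD(2)[of R M A] by simp

lemma submod_vimage:
  assumes f: "f \<in> lin R M' M X Y" "submod R M' X" "rmod R M'" "Y \<subseteq> carrier M" and A: "submod R M A"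
  shows "submod R M' {x \<in> X. f x \<in> A}"
  using submodD[OF assms(2)] submodD[OF A] lin_zero[OF f] lin_neg[OF f] lin_add[OF f(1)] lin_smult[OF f(1)]
  unfolding submod_def by auto

lemma submod_image:
  assumes f: "f \<in> lin R M' M X Y" "submod R M' X" "rmod R M'" "Y \<subseteq> carrier M"
  shows "submod R M (f ` X)"
  unfolding submod_def
proof (intro conjI ballI)
  note D = submodD[OF f(2)]
  show "f ` X \<subseteq> carrier M" using lin_mem[OF f(1)] f(4) by blast
  show "\<zero> \<in> f ` X" using lin_zero[OF f] D(2) by (metis imageI)
  show "x \<oplus> y \<in> f ` X" if "x \<in> f ` X" "y \<in> f ` X" for x y
    using that lin_add[OF f(1)] D(3) by (metis (no_types, lifting) imageE imageI)
  show "\<ominus> x \<in> f ` X" if "x \<in> f ` X" for x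
    using that lin_neg[OF f] D(4) by (metis (no_types, lifting) imageE imageI)
  show "r \<odot> x \<in> f ` X" if "r \<in> carrier R" "x \<in> f ` X" for r x
    using that lin_smult[OF f(1)] D(5) by (metis (no_types, lifting) imageE imageI)
qed

text \<open>Taking preimages is strictly monotone on submodules of the image, because each of their
  elements is a value of \<open>f\<close> on \<open>X\<close>.\<close>

lemma chain_bounded_image:
  assumes f: "f \<in> lin R M' M X Y" "submod R M' X" "rmod R M'" "Y \<subseteq> carrier M"
    and n: "chain_bounded (submods R M' X) n"
  shows "chain_bounded (submods R M (f ` X)) n"
  by (rule chain_bounded_strict_map[OF n, of _ "\<lambda>A. {x \<in> X. f x \<in> A}"])
    (auto simp: submods_def intro: submod_vimage[OF f])

lemma fl_image:
  assumes f: "f \<in> lin R M' M X Y" "submod R M' X" "rmod R M'" "Y \<subseteq> carrier M"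
    and n: "fl R M' X"
  shows "fl R M (f ` X)"
  using chain_bounded_image[OF f] n by (auto simp: fl_def)

lemma lin_inj_onI:
  assumes f: "f \<in> lin R M' M X Y" "submod R M' X" "rmod R M'" "Y \<subseteq> carrier M"
    and k: "\<And>x. x \<in> X \<Longrightarrow> f x = \<zero> \<Longrightarrow> x = \<zero>\<^bsub>M'\<^esub>"
  shows "inj_on f X"
proof (rule inj_onI)
  interpret M': rmod R M' by fact
  fix x y assume xy: "x \<in> X" "y \<in> X" "f x = f y"
  note D = submodD[OF f(2)]
  have "f (x \<oplus>\<^bsub>M'\<^esub> (\<ominus>\<^bsub>M'\<^esub> y)) = f x \<oplus> (\<ominus> f y)"
    using lin_add[OF f(1) xy(1) D(4)[OF xy(2)]] lin_neg[OF f xy(2)] by simp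
  then have "f (x \<oplus>\<^bsub>M'\<^esub> (\<ominus>\<^bsub>M'\<^esub> y)) = \<zero>"
    using xy lin_mem[OF f(1)] f(4) by (simp add: r_neg subsetD)
  then have "x \<oplus>\<^bsub>M'\<^esub> (\<ominus>\<^bsub>M'\<^esub> y) = \<zero>\<^bsub>M'\<^esub>" using k D xy by blast
  then show "x = y" using D xy by (metis M'.minus_equality M'.minus_minus M'.a_inv_closed)
qed


lemma len_attained:
  assumes "fl R M X" "submod R M X"
  obtains c where "strict_chain (submods R M X) (len R M X) c" "c (len R M X) = X"
  using assms height_attained[of "submods R M X" _ X] by (auto simp: fl_def len_def submods_def)

lemma len_ge:
  assumes "fl R M X" "strict_chain (submods R M X) k c" "c k = X"
  shows "k \<le> len R M X"
  using assms height_ge[of "submods R M X" _ k c X] by (auto simp: fl_def len_def)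

abbreviation Hom :: "'a set \<Rightarrow> 'a set \<Rightarrow> ('a \<Rightarrow> 'a) set" where
  "Hom \<equiv> lin R M M"

lemma submod_subset: "submod R M X \<Longrightarrow> X \<subseteq> carrier M"
  by (simp add: submod_def)

lemma Hom_zero: "f \<in> Hom X Y \<Longrightarrow> submod R M X \<Longrightarrow> submod R M Y \<Longrightarrow> f \<zero> = \<zero>"
  by (rule lin_zero[OF _ _ rmod_axioms submod_subset])

lemma Hom_image: "f \<in> Hom X Y \<Longrightarrow> submod R M X \<Longrightarrow> submod R M Y \<Longrightarrow> submod R M (f ` X)"
  by (rule submod_image[OF _ _ rmod_axioms submod_subset])

lemma Hom_fl_image: "f \<in> Hom X Y \<Longrightarrow> submod R M X \<Longrightarrow> submod R M Y \<Longrightarrow> fl R M X \<Longrightarrow> fl R M (f ` X)"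
  by (rule fl_image[OF _ _ rmod_axioms submod_subset])

lemma Hom_restrict: "f \<in> Hom X Y \<Longrightarrow> X' \<subseteq> X \<Longrightarrow> f \<in> Hom X' Y"
  by (rule lin_subset) (auto simp: lin_def)

text \<open>The preimages of a longest chain in the image form a chain ending at \<open>X\<close>.
  If \<open>f\<close> is not injective, the first preimage contains a nonzero kernel element, so the
  zero submodule can be put in front and the chain becomes longer by one.\<close>

lemma len_image:
  assumes f: "f \<in> Hom X Y" "submod R M X" "submod R M Y" "fl R M X"
  shows "len R M (f ` X) \<le> len R M X" and "\<not> inj_on f X \<Longrightarrow> len R M (f ` X) < len R M X"
proof -
  define l where "l = len R M (f ` X)"
  obtain c where c: "strict_chain (submods R M (f ` X)) l c" "c l = f ` X"
    using len_attained[OF Hom_fl_image[OF f] Hom_image[OF f(1-3)]] unfolding l_def .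
  define d where "d i = {x \<in> X. f x \<in> c i}" for i
  have cD: "submod R M (c i)" "c i \<subseteq> f ` X" if "i \<le> l" for i
    using c that by (auto simp: strict_chain_def submods_def)
  have d: "d i \<in> submods R M X" if "i \<le> l" for i
    unfolding d_def submods_def
    using submod_vimage[OF f(1,2) rmod_axioms submod_subset[OF f(3)] cD(1)[OF that]] by auto
  have d_less: "d i \<subset> d (Suc i)" if "i < l" for i
  proof -
    have "c i \<subset> c (Suc i)" using c that by (auto simp: strict_chain_def)
    moreover have "c (Suc i) \<subseteq> f ` X" using that by (intro cD) simp
    ultimately show ?thesis unfolding d_def by blast
  qed
  have sd: "strict_chain (submods R M X) l d" using d d_less by (simp add: strict_chain_def)
  have dl: "d l = X" using c(2) by (auto simp: d_def)
  show "len R M (f ` X) \<le> len R M X" using len_ge[OF f(4) sd dl] by (simp add: l_def)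
  assume "\<not> inj_on f X"
  then obtain x where x: "x \<in> X" "f x = \<zero>" "x \<noteq> \<zero>"
    using lin_inj_onI[OF f(1,2) rmod_axioms submod_subset[OF f(3)]] by blast
  have "x \<in> d 0" using x submodD(2)[OF cD(1)[of 0]] by (simp add: d_def)
  moreover have "\<zero> \<in> d 0" using submodD(2)[of R M "d 0"] d[of 0] by (simp add: submods_def)
  ultimately have d0: "{\<zero>} \<subset> d 0" using x(3) by blast
  define e where "e i = (case i of 0 \<Rightarrow> {\<zero>} | Suc j \<Rightarrow> d j)" for i
  have "{\<zero>} \<in> submods R M X" using submod_zero submodD(2)[OF f(2)] by (simp add: submods_def)
  then have "strict_chain (submods R M X) (Suc l) e"
    using d d_less d0 by (auto simp: strict_chain_def e_def split: nat.splits)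
  moreover have "e (Suc l) = X" using dl by (simp add: e_def)
  ultimately show "len R M (f ` X) < len R M X" using len_ge[OF f(4), of "Suc l" e] by (simp add: l_def)
qed

subsection \<open>Sums of homomorphisms into indecomposable submodules\<close>

text \<open>The summands are submodules of the ambient \<open>M\<close>; that they lie in
  \<open>V\<close> follows from \<open>V = plus A B\<close>. Agreement with
  \<open>indecomposable\<close> for the restricted record is \<open>indec_restrict\<close>.\<close>

definition indec :: "'a set \<Rightarrow> bool" where
  "indec V \<longleftrightarrow> V \<noteq> {\<zero>} \<and> (\<forall>A B. submod R M A \<and> submod R M B \<and> A \<inter> B = {\<zero>} \<and> V = plus A B
     \<longrightarrow> A = {\<zero>} \<or> B = {\<zero>})"

text \<open>\<open>IFL\<close>: indecomposable, of finite length.\<close>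
definition IFL :: "'a set set" where
  "IFL = {V. submod R M V \<and> fl R M V \<and> indec V}"

lemma IFLD: "V \<in> IFL \<Longrightarrow> submod R M V" "V \<in> IFL \<Longrightarrow> fl R M V" "V \<in> IFL \<Longrightarrow> indec V"
  by (auto simp: IFL_def)

lemma dsum_unique:
  assumes A: "submod R M A" and B: "submod R M B" and "A \<inter> B = {\<zero>}"
    and "a \<in> A" "b \<in> B" "a' \<in> A" "b' \<in> B" and e: "a \<oplus> b = a' \<oplus> b'"
  shows "a = a' \<and> b = b'"
proof -
  have c: "a \<in> carrier M" "a' \<in> carrier M" "b \<in> carrier M" "b' \<in> carrier M"
    using submodD(1)[OF A] submodD(1)[OF B] assms(4-7) by auto
  have "a \<oplus> \<ominus> a' = (a \<oplus> b) \<oplus> (\<ominus> b \<oplus> \<ominus> a')"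
    using c by (simp add: a_assoc r_neg2)
  also have "\<dots> = (a' \<oplus> b') \<oplus> (\<ominus> b \<oplus> \<ominus> a')" using e by simp
  also have "\<dots> = (a' \<oplus> \<ominus> a') \<oplus> (b' \<oplus> \<ominus> b)" using c by (simp add: a_ac)
  also have "\<dots> = b' \<oplus> \<ominus> b" using c by (simp add: r_neg)
  finally have *: "a \<oplus> \<ominus> a' = b' \<oplus> \<ominus> b" .
  have "a \<oplus> \<ominus> a' \<in> A" using submodD(3,4)[OF A] assms(4,6) by blast
  moreover have "a \<oplus> \<ominus> a' \<in> B" using submodD(3,4)[OF B] assms(5,7) unfolding * by blast
  ultimately have "a \<oplus> \<ominus> a' = \<zero>" using assms(3) by blast
  then have "a = a'" using c by (metis a_inv_closed minus_equality minus_minus)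
  then show ?thesis using e c by simp
qed

text \<open>The components are chosen pointwise; uniqueness of the decomposition forces the choices
  to be additive and compatible with the action.\<close>

lemma projections:
  assumes A: "submod R M A" and B: "submod R M B" and AB: "A \<inter> B = {\<zero>}"
  obtains p q where "p \<in> Hom (plus A B) A" "q \<in> Hom (plus A B) B"
    "\<And>x. x \<in> plus A B \<Longrightarrow> x = p x \<oplus> q x"
proof -
  have "\<exists>pq. \<forall>x\<in>plus A B. fst (pq x) \<in> A \<and> snd (pq x) \<in> B \<and> x = fst (pq x) \<oplus> snd (pq x)"
    by (rule bchoice) (auto elim!: plusE)
  then obtain pq where pq: "\<And>x. x \<in> plus A B \<Longrightarrow> fst (pq x) \<in> A \<and> snd (pq x) \<in> B \<and> x = fst (pq x) \<oplus> snd (pq x)"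
    by blast
  define p where "p x = fst (pq x)" for x
  define q where "q x = snd (pq x)" for x
  have p: "p x \<in> A" "q x \<in> B" "x = p x \<oplus> q x" if "x \<in> plus A B" for x
    using pq[OF that] by (auto simp: p_def q_def)
  have u: "p x = a \<and> q x = b" if "x = a \<oplus> b" "a \<in> A" "b \<in> B" for x a b
  proof -
    have x: "x \<in> plus A B" unfolding that(1) by (rule plusI[OF that(2,3)])
    show ?thesis
      using p[OF x] that by (intro dsum_unique[OF A B AB]) auto
  qed
  note c = submodD(1)[OF A] submodD(1)[OF B]
  have add: "p (x \<oplus> y) = p x \<oplus> p y \<and> q (x \<oplus> y) = q x \<oplus> q y" if "x \<in> plus A B" "y \<in> plus A B" for x y
  proof (rule u)
    show "x \<oplus> y = p x \<oplus> p y \<oplus> (q x \<oplus> q y)"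
    proof -
      have "x \<oplus> y = (p x \<oplus> q x) \<oplus> (p y \<oplus> q y)" using p(3) that by simp
      also have "\<dots> = p x \<oplus> p y \<oplus> (q x \<oplus> q y)"
        using p(1,2)[OF that(1)] p(1,2)[OF that(2)] c by (simp add: a_ac)
      finally show ?thesis .
    qed
  qed (use p that submodD(3)[OF A] submodD(3)[OF B] in auto)
  have sm: "p (r \<odot> x) = r \<odot> p x \<and> q (r \<odot> x) = r \<odot> q x" if "x \<in> plus A B" "r \<in> carrier R" for x r
  proof (rule u)
    have "r \<odot> x = r \<odot> (p x \<oplus> q x)" using p(3) that by simp
    also have "\<dots> = r \<odot> p x \<oplus> r \<odot> q x" using p(1,2)[OF that(1)] c that by (simp add: smult_add)
    finally show "r \<odot> x = r \<odot> p x \<oplus> r \<odot> q x" .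
  qed (use p that submodD(5)[OF A] submodD(5)[OF B] in auto)
  show thesis
  proof (rule that)
    show "p \<in> Hom (plus A B) A" "q \<in> Hom (plus A B) B"
      using p add sm by (auto intro!: linI)
    show "x = p x \<oplus> q x" if "x \<in> plus A B" for x by (rule p[OF that])
  qed
qed

text \<open>Homomorphisms are arbitrary functions of which only the values on \<open>X\<close> matter; accordingly
  \<open>asum X P\<close>, the sums of members of \<open>P\<close>, is closed under changes outside \<open>X\<close>.\<close>
inductive_set asum :: "'a set \<Rightarrow> ('a \<Rightarrow> 'a) set \<Rightarrow> ('a \<Rightarrow> 'a) set" for X P where
  asum_zero: "(\<And>x. x \<in> X \<Longrightarrow> h x = \<zero>) \<Longrightarrow> h \<in> asum X P"
| asum_add: "g \<in> P \<Longrightarrow> h \<in> asum X P \<Longrightarrow> (\<And>x. x \<in> X \<Longrightarrow> k x = g x \<oplus> h x) \<Longrightarrow> k \<in> asum X P"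

lemma asum_carrier: "h \<in> asum X P \<Longrightarrow> P \<subseteq> X \<rightarrow> carrier M \<Longrightarrow> x \<in> X \<Longrightarrow> h x \<in> carrier M"
  by (induction rule: asum.induct) auto

lemma asum_cong: "h \<in> asum X P \<Longrightarrow> (\<And>x. x \<in> X \<Longrightarrow> h' x = h x) \<Longrightarrow> h' \<in> asum X P"
  by (induction rule: asum.induct) (auto intro: asum_zero asum_add)

lemma asum_base:
  assumes "g \<in> P" "P \<subseteq> X \<rightarrow> carrier M"
  shows "g \<in> asum X P"
proof (rule asum_add[OF assms(1)])
  show "(\<lambda>_. \<zero>) \<in> asum X P" by (rule asum_zero) simp
  show "g x = g x \<oplus> \<zero>" if "x \<in> X" for x
  proof -
    have "g x \<in> carrier M" using assms that by auto
    then show ?thesis by simp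
  qed
qed

lemma asum_plus:
  assumes "h \<in> asum X P" "h' \<in> asum X P" "P \<subseteq> X \<rightarrow> carrier M"
  shows "(\<lambda>x. h x \<oplus> h' x) \<in> asum X P"
  using assms(1)
proof (induction rule: asum.induct)
  case (asum_zero h)
  then show ?case
    using asum_carrier[OF assms(2,3)] by (intro asum_cong[OF assms(2)]) simp
next
  case (asum_add g h k)
  have "g x \<in> carrier M \<and> h x \<in> carrier M \<and> h' x \<in> carrier M" if "x \<in> X" for x
    using that asum_carrier[OF asum_add.hyps(2) assms(3)] asum_carrier[OF assms(2,3)] asum_add.hyps(1) assms(3) by auto
  then show ?case
    using asum_add.hyps(3) by (intro asum.asum_add[OF asum_add.hyps(1) asum_add.IH]) (simp add: a_assoc)
qed

text \<open>Precomposition distributes over sums. This is the substitution rule by which each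
  summand is in turn replaced by a sum.\<close>

lemma asum_bind:
  assumes "h \<in> asum X P" "\<And>g. g \<in> P \<Longrightarrow> g \<circ> a \<in> asum Y Q" "a \<in> Y \<rightarrow> X" "Q \<subseteq> Y \<rightarrow> carrier M"
  shows "h \<circ> a \<in> asum Y Q"
  using assms(1)
proof (induction rule: asum.induct)
  case (asum_zero h)
  then show ?case using assms(3) by (intro asum.asum_zero) auto
next
  case (asum_add g h k)
  have "(\<lambda>x. (g \<circ> a) x \<oplus> (h \<circ> a) x) \<in> asum Y Q"
    using asum_plus[OF assms(2)[OF asum_add.hyps(1)] asum_add.IH assms(4)] .
  then show ?case by (rule asum_cong) (use asum_add.hyps(3) assms(3) in auto)
qed

lemma asum_neg:
  assumes "h \<in> asum X P" "P \<subseteq> X \<rightarrow> carrier M" "\<And>g. g \<in> P \<Longrightarrow> (\<lambda>x. \<ominus> g x) \<in> P"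
  shows "(\<lambda>x. \<ominus> h x) \<in> asum X P"
  using assms(1)
proof (induction rule: asum.induct)
  case (asum_zero h)
  then show ?case by (intro asum.asum_zero) auto
next
  case (asum_add g h k)
  have "g x \<in> carrier M \<and> h x \<in> carrier M" if "x \<in> X" for x
    using that asum_carrier[OF asum_add.hyps(2) assms(2)] asum_add.hyps(1) assms(2) by auto
  then show ?case
    using asum_add.hyps(3) by (intro asum.asum_add[OF assms(3)[OF asum_add.hyps(1)] asum_add.IH]) (simp add: minus_add)
qed

lemma asum_finsum:
  assumes "finite F" "\<And>V. V \<in> F \<Longrightarrow> a V \<in> asum X P" "P \<subseteq> X \<rightarrow> carrier M"
  shows "(\<lambda>x. \<Oplus>V\<in>F. a V x) \<in> asum X P"
  using assms(1,2)
proof (induction F)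
  case empty
  then show ?case by (intro asum_zero) simp
next
  case (insert V F)
  have "(\<lambda>x. a V x \<oplus> (\<Oplus>V\<in>F. a V x)) \<in> asum X P"
    using insert assms(3) by (intro asum_plus) auto
  then show ?case
  proof (rule asum_cong)
    fix x assume x: "x \<in> X"
    show "(\<Oplus>V\<in>insert V F. a V x) = a V x \<oplus> (\<Oplus>V\<in>F. a V x)"
      using insert.hyps asum_carrier[OF insert.prems assms(3) x] by (intro finsum_insert) auto
  qed
qed

lemma Hom_carrier: "f \<in> Hom X Y \<Longrightarrow> submod R M Y \<Longrightarrow> f \<in> X \<rightarrow> carrier M"
  using submod_subset by (auto simp: lin_def)

lemma id_Hom: "X \<subseteq> Y \<Longrightarrow> (\<lambda>x. x) \<in> Hom X Y"
  by (auto simp: lin_def)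

definition homs :: "'a set \<Rightarrow> 'a set set \<Rightarrow> ('a \<Rightarrow> 'a) set" where
  "homs X \<V> = {g. \<exists>V\<in>\<V>. g \<in> Hom X V}"

lemma homs_carrier: "\<V> \<subseteq> IFL \<Longrightarrow> homs X \<V> \<subseteq> X \<rightarrow> carrier M"
  unfolding homs_def using Hom_carrier IFLD(1) by blast

lemma homs_comp: "f \<in> homs X \<V> \<Longrightarrow> a \<in> Hom Y X \<Longrightarrow> f \<circ> a \<in> homs Y \<V>"
  unfolding homs_def using lin_comp by blast

lemma asum_homs_comp:
  assumes "h \<in> asum X (homs X \<V>)" "a \<in> Hom Y X" "\<V> \<subseteq> IFL"
  shows "h \<circ> a \<in> asum Y (homs Y \<V>)"
proof (rule asum_bind[OF assms(1)])
  show "g \<circ> a \<in> asum Y (homs Y \<V>)" if "g \<in> homs X \<V>" for g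
    by (rule asum_base[OF homs_comp[OF that assms(2)] homs_carrier[OF assms(3)]])
qed (use assms homs_carrier in \<open>auto simp: lin_def\<close>)

text \<open>Induction on length: if \<open>X\<close> splits properly, the identity is the sum of the
  two projections, and each factors through a shorter summand whose identity is already such a
  sum.\<close>

lemma id_in_asum_homs:
  assumes "fl R M X" "submod R M X"
  shows "(\<lambda>x. x) \<in> asum X (homs X IFL)"
  using assms
proof (induction "len R M X" arbitrary: X rule: less_induct)
  case less
  consider "X = {\<zero>}" | "indec X" | A B where "submod R M A" "submod R M B" "A \<inter> B = {\<zero>}"
    "X = plus A B" "A \<noteq> {\<zero>}" "B \<noteq> {\<zero>}"
    by (auto simp: indec_def)
  then show ?case
  proof cases
    case 1
    then show ?thesis by (auto intro: asum_zero)
  next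
    case 2
    then have "(\<lambda>x. x) \<in> homs X IFL" using less.prems id_Hom[of X X] by (auto simp: homs_def IFL_def)
    then show ?thesis by (rule asum_base[OF _ homs_carrier]) simp
  next
    case 3
    obtain p q where p: "p \<in> Hom X A" and q: "q \<in> Hom X B"
      and pq: "\<And>x. x \<in> X \<Longrightarrow> x = p x \<oplus> q x"
      using projections[OF 3(1-3)] unfolding 3(4)[symmetric] by blast
    have up: "A \<subseteq> X" "B \<subseteq> X" using plus_upper[OF 3(1,2)] 3(4) by auto
    have "A \<noteq> X" using up 3(3,6) by blast
    moreover have "B \<noteq> X" using up 3(3,5) by blast
    ultimately have "len R M A < len R M X" "len R M B < len R M X"
      using up 3(1,2) less.prems by (auto intro!: len_less)
    then have A: "(\<lambda>x. x) \<in> asum A (homs A IFL)" and B: "(\<lambda>x. x) \<in> asum B (homs B IFL)"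
      using less.hyps 3(1,2) fl_subset[OF less.prems(1)] up by auto
    have "(\<lambda>x. ((\<lambda>x. x) \<circ> p) x \<oplus> ((\<lambda>x. x) \<circ> q) x) \<in> asum X (homs X IFL)"
      by (rule asum_plus[OF asum_homs_comp[OF A p] asum_homs_comp[OF B q] homs_carrier]) auto
    then show ?thesis by (rule asum_cong) (use pq in auto)
  qed
qed


lemma Hom_vimage:
  assumes "f \<in> Hom X Y" "submod R M X" "submod R M Y" "submod R M A"
  shows "submod R M {x \<in> X. f x \<in> A}"
  by (rule submod_vimage[OF assms(1,2) rmod_axioms submod_subset[OF assms(3)] assms(4)])

lemma Hom_neg_arg: "f \<in> Hom X Y \<Longrightarrow> submod R M X \<Longrightarrow> submod R M Y \<Longrightarrow> x \<in> X \<Longrightarrow> f (\<ominus> x) = \<ominus> f x"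
  by (rule lin_neg[OF _ _ rmod_axioms submod_subset])

subsection \<open>The Harada-Sai lemma\<close>

text \<open>Since \<open>f\<close> maps \<open>I\<close> bijectively onto all of its image,
  \<open>V\<close> is the direct sum of \<open>I\<close> and the kernel of \<open>f\<close>.
  Indecomposability makes the kernel zero, and then \<open>I\<close> is everything.\<close>

lemma indec_split:
  assumes V: "V \<in> IFL" and Y: "submod R M Y" and f: "f \<in> Hom V Y"
    and I: "submod R M I" "I \<subseteq> V" "I \<noteq> {\<zero>}" "inj_on f I" "f ` V \<subseteq> f ` I"
  shows "inj_on f V \<and> I = V"
proof -
  note sV = IFLD(1)[OF V]
  define K where "K = {x \<in> V. f x \<in> {\<zero>}}"
  have K: "submod R M K" unfolding K_def by (rule Hom_vimage[OF f sV Y submod_zero])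
  have f0: "f \<zero> = \<zero>" by (rule Hom_zero[OF f sV Y])
  have z: "\<zero> \<in> I" "\<zero> \<in> K" using submodD(2) I(1) K by auto
  have "I \<inter> K = {\<zero>}"
  proof -
    have "x = \<zero>" if "x \<in> I" "x \<in> K" for x
      using inj_onD[OF I(4), of x \<zero>] that z(1) f0 by (simp add: K_def)
    then show ?thesis using z by blast
  qed
  moreover have "V = plus I K"
  proof
    show "plus I K \<subseteq> V" by (rule plus_least[OF sV I(2)]) (auto simp: K_def)
    show "V \<subseteq> plus I K"
    proof
      fix x assume x: "x \<in> V"
      then obtain i where i: "i \<in> I" "f x = f i" using I(5) by blast
      have iV: "i \<in> V" "\<ominus> i \<in> V" using i I(2) submodD(4)[OF sV] by auto
      have c: "i \<in> carrier M" "x \<in> carrier M" using submodD(1)[OF sV] iV x by auto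
      have fi: "f i \<in> carrier M" using lin_mem[OF f iV(1)] submodD(1)[OF Y] by simp
      have "f (\<ominus> i \<oplus> x) = \<ominus> f i \<oplus> f x"
        using lin_add[OF f iV(2) x] Hom_neg_arg[OF f sV Y iV(1)] by simp
      then have "f (\<ominus> i \<oplus> x) = \<zero>" using i(2) fi by (simp add: l_neg)
      then have "\<ominus> i \<oplus> x \<in> K" using submodD(3)[OF sV iV(2) x] by (simp add: K_def)
      then have "i \<oplus> (\<ominus> i \<oplus> x) \<in> plus I K" by (rule plusI[OF i(1)])
      then show "x \<in> plus I K" using c by (simp add: r_neg2)
    qed
  qed
  ultimately have "K = {\<zero>}" using IFLD(3)[OF V] I(1,3) K unfolding indec_def by blast
  have "inj_on f V"
  proof (rule lin_inj_onI[OF f sV rmod_axioms submod_subset[OF Y]])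
    show "x = \<zero>" if "x \<in> V" "f x = \<zero>" for x
      using that \<open>K = {\<zero>}\<close> unfolding K_def by blast
  qed
  moreover have "I = V"
    using \<open>inj_on f V\<close> I(2,5) inj_on_image_eq_iff[of f V V I] by blast
  ultimately show ?thesis by blast
qed

text \<open>The index is the exact number of non-isomorphisms composed. Every intermediate module
  lies in \<open>IFL\<close>, and factors are added at the target end.\<close>

inductive radcomp :: "nat \<Rightarrow> 'a set \<Rightarrow> 'a set \<Rightarrow> ('a \<Rightarrow> 'a) \<Rightarrow> bool" where
  radcomp_0: "W \<in> IFL \<Longrightarrow> radcomp 0 W W (\<lambda>x. x)"
| radcomp_Suc: "radcomp n W V g \<Longrightarrow> V' \<in> IFL \<Longrightarrow> f \<in> Hom V V' \<Longrightarrow> \<not> bij_betw f V V' \<Longrightarrow> radcomp (Suc n) W V' (f \<circ> g)"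

lemma radcomp_Hom: "radcomp n W V g \<Longrightarrow> W \<in> IFL \<and> V \<in> IFL \<and> g \<in> Hom W V"
  by (induction rule: radcomp.induct) (auto simp del: comp_apply intro: id_Hom lin_comp)

lemma radcomp_split: "radcomp (m + k) W V g \<Longrightarrow> \<exists>U g1 g2. radcomp m W U g1 \<and> radcomp k U V g2 \<and> g = g2 \<circ> g1"
proof (induction k arbitrary: V g)
  case 0
  have "radcomp 0 V V (\<lambda>x. x)" using radcomp_Hom[OF 0] radcomp_0 by blast
  moreover have "g = (\<lambda>x. x) \<circ> g" by auto
  ultimately show ?case using 0 by auto
next
  case (Suc k)
  from Suc.prems have "radcomp (Suc (m + k)) W V g" by simp
  then obtain V1 g' f where *: "radcomp (m + k) W V1 g'" "V \<in> IFL" "f \<in> Hom V1 V" "\<not> bij_betw f V1 V" "g = f \<circ> g'"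
    by (cases rule: radcomp.cases) auto
  obtain U g1 g2 where U: "radcomp m W U g1" "radcomp k U V1 g2" "g' = g2 \<circ> g1" using Suc.IH[OF *(1)] by blast
  have "radcomp (Suc k) U V (f \<circ> g2)" by (rule radcomp_Suc[OF U(2) *(2-4)])
  moreover have "g = (f \<circ> g2) \<circ> g1" using *(5) U(3) by (simp add: comp_assoc)
  ultimately show ?case using U(1) by blast
qed

lemma radcomp_one: "radcomp 1 W V g \<Longrightarrow> g \<in> Hom W V \<and> \<not> bij_betw g W V"
proof -
  assume "radcomp 1 W V g"
  then obtain V1 g' f where *: "radcomp 0 W V1 g'" "f \<in> Hom V1 V" "\<not> bij_betw f V1 V" "g = f \<circ> g'"
    by (cases rule: radcomp.cases) auto
  from *(1) have "V1 = W" "g' = (\<lambda>x. x)" by (cases rule: radcomp.cases, simp)+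
  then show ?thesis using * by (simp add: comp_def)
qed

lemma len_zero: "len R M {\<zero>} = 0"
proof -
  have bd: "chain_bounded (submods R M {\<zero>}) 0"
    by (rule chain_bounded_rank[of _ "\<lambda>_. 0"]) (auto simp: submods_def dest: submodD(2))
  show ?thesis using height_le[OF bd, of "{\<zero>}"] submod_zero by (simp add: len_def submods_def)
qed

text \<open>If the image of \<open>g\<^sub>2 \<circ> h \<circ> g\<^sub>1\<close> is as long as the bound on the images of \<open>g\<^sub>1\<close> and \<open>g\<^sub>2\<close>, then the
  image of \<open>g\<^sub>1\<close> is a complement of \<open>ker (g\<^sub>2 \<circ> h)\<close> and its image under \<open>h\<close> one of \<open>ker g\<^sub>2\<close>; by
  indecomposability \<open>h\<close> is bijective.\<close>
lemma harada_sai: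
  assumes b: "\<And>V. V \<in> IFL \<Longrightarrow> len R M V \<le> b"
  shows "n \<le> b \<Longrightarrow> radcomp (2 ^ n - 1) W V g \<Longrightarrow> len R M (g ` W) \<le> b - n"
proof (induction n arbitrary: W V g)
  case 0
  have g: "W \<in> IFL" "V \<in> IFL" "g \<in> Hom W V" using radcomp_Hom[OF 0(2)] by auto
  have "len R M (g ` W) \<le> len R M W" using g by (intro len_image) (auto intro: IFLD)
  then show ?case using b[OF g(1)] by simp
next
  case (Suc n)
  \<comment> \<open>The number of factors satisfies \<open>2 ^ Suc n - 1 = N + 1 + N\<close>: two
    composites to which the induction hypothesis applies, with a single non-isomorphism
    \<open>h\<close> between them.\<close>
  define N :: nat where "N = 2 ^ n - 1"
  have "radcomp (N + (1 + N)) W V g"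
  proof -
    have "(2::nat) ^ Suc n - 1 = N + (1 + N)" by (simp add: N_def)
    then show ?thesis using Suc.prems(2) by simp
  qed
  then obtain W1 g1 g' where 1: "radcomp N W W1 g1" "radcomp (1 + N) W1 V g'" "g = g' \<circ> g1"
    using radcomp_split by blast
  then obtain W2 h g2 where 2: "radcomp 1 W1 W2 h" "radcomp N W2 V g2" "g' = g2 \<circ> h"
    using radcomp_split by blast
  have I: "W \<in> IFL" "W1 \<in> IFL" "W2 \<in> IFL" "V \<in> IFL" "g1 \<in> Hom W W1" "g2 \<in> Hom W2 V"
    using radcomp_Hom 1(1) 2(2) by blast+
  have h: "h \<in> Hom W1 W2" "\<not> bij_betw h W1 W2" using radcomp_one[OF 2(1)] by auto
  have n: "n \<le> b" using Suc.prems(1) by simp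
  have l1: "len R M (g1 ` W) \<le> b - n" and l2: "len R M (g2 ` W2) \<le> b - n"
    using Suc.IH[OF n] 1(1) 2(2) unfolding N_def by auto
  define A where "A = g1 ` W"
  have A: "submod R M A" "fl R M A" "A \<subseteq> W1"
    unfolding A_def using Hom_image[OF I(5)] Hom_fl_image[OF I(5)] I(1,2) lin_mem[OF I(5)]
    by (auto intro: IFLD)
  define f where "f = g2 \<circ> h"
  have f: "f \<in> Hom W1 V" unfolding f_def by (rule lin_comp[OF h(1) I(6)])
  have fA: "f ` A = g ` W" unfolding A_def f_def 1(3) 2(3) by (simp add: image_comp comp_assoc)
  have fA': "f \<in> Hom A V" by (rule Hom_restrict[OF f A(3)])
  have sfA: "submod R M (f ` A)" by (rule Hom_image[OF fA' A(1) IFLD(1)[OF I(4)]])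
  define C where "C = h ` A"
  have hA: "h \<in> Hom A W2" by (rule Hom_restrict[OF h(1) A(3)])
  have C: "submod R M C" "fl R M C" "C \<subseteq> W2"
    unfolding C_def using Hom_image[OF hA A(1)] Hom_fl_image[OF hA A(1)] A(2) I(3) lin_mem[OF hA]
    by (auto intro: IFLD)
  have g2C: "g2 \<in> Hom C V" by (rule Hom_restrict[OF I(6) C(3)])
  have fC: "g2 ` C = f ` A" unfolding C_def f_def by (simp add: image_comp)
  note sV = IFLD(1)[OF I(4)]
  show ?case
  proof (rule ccontr)
    assume "\<not> len R M (g ` W) \<le> b - Suc n"
    \<comment> \<open>The image exceeds \<open>b - Suc n\<close>, so it is nonzero and at least as
      long as the bound for the images of \<open>g1\<close> and \<open>g2\<close>.\<close>
    then have big: "b - n \<le> len R M (f ` A)" "0 < len R M (f ` A)" unfolding fA by auto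
    have im2: "submod R M (g2 ` W2)" "fl R M (g2 ` W2)"
      using Hom_image[OF I(6)] Hom_fl_image[OF I(6)] I(3) sV by (auto intro: IFLD)
    have "f ` A = g2 ` W2"
      using big(1) l2 fC C(3) by (intro len_eq[OF im2(2) sfA im2(1)]) auto
    have fne: "f ` A \<noteq> {\<zero>}"
    proof
      assume "f ` A = {\<zero>}"
      then show False using big(2) len_zero by simp
    qed
    \<comment> \<open>A kernel would make the image of \<open>A\<close> strictly shorter than
      \<open>A\<close>, whose length is at most \<open>b - n\<close>.\<close>
    have "inj_on f A" using len_image(2)[OF fA' A(1) sV A(2)] l1 big(1) unfolding A_def[symmetric] by linarith
    have Ane: "A \<noteq> {\<zero>}" using fne Hom_zero[OF fA' A(1) sV] by auto
    have "f ` W1 \<subseteq> f ` A" using \<open>f ` A = g2 ` W2\<close> lin_mem[OF h(1)] by (auto simp: f_def)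
    then have injh: "inj_on h W1"
      using indec_split[OF I(2) sV f A(1,3) Ane \<open>inj_on f A\<close>] unfolding f_def by (blast dest: inj_on_imageI2)
    have "len R M C \<le> len R M A" unfolding C_def by (rule len_image(1)[OF hA A(1) IFLD(1)[OF I(3)] A(2)])
    then have "inj_on g2 C" using len_image(2)[OF g2C C(1) sV C(2)] l1 big(1) fC unfolding A_def[symmetric] by fastforce
    have Cne: "C \<noteq> {\<zero>}" using fne fC Hom_zero[OF g2C C(1) sV] by auto
    have "g2 ` W2 \<subseteq> g2 ` C" using \<open>f ` A = g2 ` W2\<close> fC by simp
    then have "C = W2" using indec_split[OF I(3) sV I(6) C(1,3) Cne \<open>inj_on g2 C\<close>] by blast
    then have "h ` W1 = W2" using A(3) lin_mem[OF h(1)] unfolding C_def by blast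
    then show False using injh h(2) by (simp add: bij_betw_def)
  qed
qed

lemma radcomp_eventually_zero:
  assumes "\<And>V. V \<in> IFL \<Longrightarrow> len R M V \<le> b" and "radcomp (2 ^ b - 1) W V g" and "x \<in> W"
  shows "g x = \<zero>"
proof -
  have g: "g \<in> Hom W V" "submod R M W" "submod R M V" "fl R M W"
    using radcomp_Hom[OF assms(2)] by (auto intro: IFLD)
  have "len R M (g ` W) = 0" using harada_sai[of b b W V g] assms by simp
  then have "g ` W = {\<zero>}" by (rule len_zero_iff[OF Hom_fl_image[OF g] Hom_image[OF g(1-3)]])
  then show ?thesis using assms(3) by blast
qed


section \<open>Pointwise operations on homomorphisms and finite sums\<close>

lemma Hom_neg:
  assumes f: "f \<in> Hom X Y" and Y: "submod R M Y"
  shows "(\<lambda>x. \<ominus> f x) \<in> Hom X Y"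
proof (rule linI)
  have c: "f x \<in> carrier M" if "x \<in> X" for x using lin_mem[OF f that] submodD(1)[OF Y] by blast
  show "\<ominus> f x \<in> Y" if "x \<in> X" for x using lin_mem[OF f that] submodD(4)[OF Y] by blast
  show "\<ominus> f (x \<oplus> y) = \<ominus> f x \<oplus> \<ominus> f y" if "x \<in> X" "y \<in> X" for x y
    using lin_add[OF f that] c that by (simp add: minus_add)
  show "\<ominus> f (r \<odot> x) = r \<odot> (\<ominus> f x)" if "r \<in> carrier R" "x \<in> X" for r x
    using lin_smult[OF f that] c that by (simp add: smult_neg)
qed

lemma Hom_plus:
  assumes f: "f \<in> Hom X Y" and g: "g \<in> Hom X Y" and Y: "submod R M Y"
  shows "(\<lambda>x. f x \<oplus> g x) \<in> Hom X Y"
proof (rule linI)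
  have c: "f x \<in> carrier M" "g x \<in> carrier M" if "x \<in> X" for x
    using lin_mem[OF f that] lin_mem[OF g that] submodD(1)[OF Y] by auto
  show "f x \<oplus> g x \<in> Y" if "x \<in> X" for x
    using lin_mem[OF f that] lin_mem[OF g that] submodD(3)[OF Y] by blast
  show "f (x \<oplus> y) \<oplus> g (x \<oplus> y) = (f x \<oplus> g x) \<oplus> (f y \<oplus> g y)" if "x \<in> X" "y \<in> X" for x y
    using lin_add[OF f that] lin_add[OF g that] c that by (simp add: a_ac)
  show "f (r \<odot> x) \<oplus> g (r \<odot> x) = r \<odot> (f x \<oplus> g x)" if "r \<in> carrier R" "x \<in> X" for r x
    using lin_smult[OF f that] lin_smult[OF g that] c that by (simp add: smult_add)
qed

lemma Hom_const_zero: "submod R M Y \<Longrightarrow> (\<lambda>_. \<zero>) \<in> Hom X Y"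
  by (rule linI) (simp_all add: smult_zero submodD(2))

lemma finsum_submod: "finite F \<Longrightarrow> submod R M N \<Longrightarrow> (\<And>c. c \<in> F \<Longrightarrow> p c \<in> N) \<Longrightarrow> finsum M p F \<in> N"
proof (induction F rule: finite_induct)
  case empty then show ?case by (simp add: submodD(2))
next
  case (insert c F)
  have "finsum M p (insert c F) = p c \<oplus> finsum M p F"
    using insert submodD(1)[OF insert.prems(1)] by (intro finsum_insert) auto
  then show ?case using insert submodD(3)[OF insert.prems(1)] by simp
qed

lemma Hom_finsum:
  assumes f: "f \<in> Hom X Y" and X: "submod R M X" and Y: "submod R M Y"
  shows "finite F \<Longrightarrow> (\<And>c. c \<in> F \<Longrightarrow> p c \<in> X) \<Longrightarrow> f (finsum M p F) = (\<Oplus>c\<in>F. f (p c))"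
proof (induction F rule: finite_induct)
  case empty then show ?case using Hom_zero[OF f X Y] by simp
next
  case (insert c F)
  have 1: "finsum M p (insert c F) = p c \<oplus> finsum M p F"
    using insert submodD(1)[OF X] by (intro finsum_insert) auto
  have fp: "f (p d) \<in> carrier M" if "d \<in> insert c F" for d
    using lin_mem[OF f insert.prems[OF that]] submodD(1)[OF Y] by blast
  have 2: "(\<Oplus>c\<in>insert c F. f (p c)) = f (p c) \<oplus> (\<Oplus>c\<in>F. f (p c))"
    using insert.hyps fp by (intro finsum_insert) auto
  have "f (p c \<oplus> finsum M p F) = f (p c) \<oplus> f (finsum M p F)"
    using insert.prems by (intro lin_add[OF f] finsum_submod[OF insert.hyps(1) X]) auto
  then show ?case using 1 2 insert by simp
qed

subsection \<open>Families independent modulo the radical\<close>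

text \<open>Being an isomorphism refers to the chosen target: an isomorphism onto \<open>V\<close>
  becomes radical once it is regarded as a map into a strictly larger member of \<open>IFL\<close>.
  Closure under addition is supplied by \<open>asum\<close>.\<close>

definition rad :: "'a set \<Rightarrow> ('a \<Rightarrow> 'a) set" where
  "rad W = {g. \<exists>V\<in>IFL. g \<in> Hom W V \<and> \<not> bij_betw g W V}"

lemma rad_subset: "rad W \<subseteq> homs W IFL"
  by (auto simp: rad_def homs_def)

lemma rad_carrier: "rad W \<subseteq> W \<rightarrow> carrier M"
  using rad_subset homs_carrier by blast

lemma bij_uminus: "submod R M V \<Longrightarrow> bij_betw (\<lambda>x. \<ominus> x) V V"
  using submodD(1,4)[of R M V] by (intro bij_betw_byWitness[of _ "\<lambda>x. \<ominus> x"]) auto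

lemma rad_neg: "g \<in> rad W \<Longrightarrow> (\<lambda>x. \<ominus> g x) \<in> rad W"
proof -
  assume "g \<in> rad W"
  then obtain V where V: "V \<in> IFL" "g \<in> Hom W V" "\<not> bij_betw g W V" by (auto simp: rad_def)
  have "bij_betw g W V" if "bij_betw (\<lambda>x. \<ominus> g x) W V"
  proof -
    have "bij_betw ((\<lambda>x. \<ominus> x) \<circ> (\<lambda>x. \<ominus> g x)) W V"
      by (rule bij_betw_trans[OF that bij_uminus[OF IFLD(1)[OF V(1)]]])
    moreover have "((\<lambda>x. \<ominus> x) \<circ> (\<lambda>x. \<ominus> g x)) x = g x" if "x \<in> W" for x
      using lin_mem[OF V(2) that] submodD(1)[OF IFLD(1)[OF V(1)]] by simp
    ultimately show ?thesis using bij_betw_cong by blast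
  qed
  then show ?thesis using V Hom_neg[OF V(2) IFLD(1)[OF V(1)]] by (auto simp: rad_def)
qed

lemma homs_neg: "\<V> \<subseteq> IFL \<Longrightarrow> g \<in> homs W \<V> \<Longrightarrow> (\<lambda>x. \<ominus> g x) \<in> homs W \<V>"
  unfolding homs_def using Hom_neg IFLD(1) by blast

lemma rad_comp_bij:
  assumes "g \<in> rad W'" "c \<in> Hom W W'" "bij_betw c W W'"
  shows "g \<circ> c \<in> rad W"
proof -
  obtain V where V: "V \<in> IFL" "g \<in> Hom W' V" "\<not> bij_betw g W' V" using assms(1) by (auto simp: rad_def)
  then show ?thesis
    using lin_comp[OF assms(2) V(2)] bij_betw_comp_iff[OF assms(3), of g V] unfolding rad_def by blast
qed

text \<open>The inclusions of the members of \<open>B\<close> are independent in \<open>Hom(-, M)\<close> modulo radical maps, the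
  coefficients \<open>a V : W \<rightarrow> V\<close> counting as zero when they are not isomorphisms.\<close>
definition indep :: "'a set set \<Rightarrow> bool" where
  "indep B \<longleftrightarrow> B \<subseteq> IFL \<and> (\<forall>W\<in>IFL. \<forall>F a. finite F \<and> F \<subseteq> B \<and> (\<forall>V\<in>F. a V \<in> Hom W V) \<and>
     (\<lambda>x. \<Oplus>V\<in>F. a V x) \<in> asum W (rad W) \<longrightarrow> (\<forall>V\<in>F. \<not> bij_betw (a V) W V))"

definition max_indep :: "'a set set \<Rightarrow> bool" where
  "max_indep B \<longleftrightarrow> indep B \<and> (\<forall>B'. indep B' \<and> B \<subseteq> B' \<longrightarrow> B' = B)"

lemma max_indepD: "max_indep B \<Longrightarrow> indep B" "max_indep B \<Longrightarrow> B \<subseteq> IFL"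
  by (auto simp: max_indep_def indep_def)

definition rad_nilpotent :: "nat \<Rightarrow> bool" where
  "rad_nilpotent N \<longleftrightarrow> (\<forall>W V g. radcomp N W V g \<longrightarrow> (\<forall>x\<in>W. g x = \<zero>))"

text \<open>Zorn's lemma applies because a failure of independence involves only finitely many
  members, which already lie in one member of the chain.\<close>

lemma max_indep_exists: "\<exists>B. max_indep B"
proof -
  have "\<exists>B\<in>Collect indep. \<forall>B'\<in>Collect indep. B \<subseteq> B' \<longrightarrow> B' = B"
  proof (rule subset_Zorn')
    fix C assume C: "subset.chain (Collect indep) C"
    have CI: "indep D" if "D \<in> C" for D using C that by (auto simp: subset.chain_def)
    have "indep (\<Union>C)"
      unfolding indep_def
    proof (intro conjI ballI allI impI)
      show "\<Union>C \<subseteq> IFL" using CI by (auto simp: indep_def)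
      fix W F a V
      assume W: "W \<in> IFL" and V: "V \<in> F"
        and F: "finite F \<and> F \<subseteq> \<Union>C \<and> (\<forall>V\<in>F. a V \<in> Hom W V) \<and> (\<lambda>x. \<Oplus>V\<in>F. a V x) \<in> asum W (rad W)"
      have "C \<noteq> {}" using F V by blast
      then obtain D where "D \<in> C" "F \<subseteq> D"
        using finite_subset_Union_chain[of F C "Collect indep"] F C by blast
      then show "\<not> bij_betw (a V) W V" using CI[of D] W F V unfolding indep_def by blast
    qed
    then show "\<Union>C \<in> Collect indep" by simp
  qed
  then show ?thesis by (auto simp: max_indep_def)
qed

text \<open>For \<open>W\<close> outside \<open>B\<close>, maximality yields a nontrivial relation
  over some \<open>U\<close> among \<open>W\<close> and members of \<open>B\<close>. Its coefficient
  at \<open>W\<close> turns out to be an isomorphism, so the relation can be solved for the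
  inclusion of \<open>W\<close>.\<close>

lemma span_mod_rad:
  assumes B: "max_indep B" and W: "W \<in> IFL"
  obtains l r where "l \<in> asum W (homs W B)" "r \<in> asum W (rad W)" "\<And>x. x \<in> W \<Longrightarrow> x = l x \<oplus> r x"
proof (cases "W \<in> B")
  case True
  have "(\<lambda>x. x) \<in> homs W B" using True id_Hom[of W W] by (auto simp: homs_def)
  then have "(\<lambda>x. x) \<in> asum W (homs W B)"
    using homs_carrier[OF max_indepD(2)[OF B]] by (rule asum_base)
  moreover have "(\<lambda>_. \<zero>) \<in> asum W (rad W)" by (rule asum_zero) simp
  ultimately show ?thesis using that submodD(1)[OF IFLD(1)[OF W]] by simp
next
  case False
  have BI: "B \<subseteq> IFL" by (rule max_indepD(2)[OF B])
  have "\<not> indep (insert W B)" using B False unfolding max_indep_def by blast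
  then obtain U F a V0 where U: "U \<in> IFL" and F: "finite F" "F \<subseteq> insert W B"
    and a: "\<And>V. V \<in> F \<Longrightarrow> a V \<in> Hom U V" and s: "(\<lambda>x. \<Oplus>V\<in>F. a V x) \<in> asum U (rad U)"
    and V0: "V0 \<in> F" "bij_betw (a V0) U V0"
    using BI W unfolding indep_def by blast
  define G where "G = F - {W}"
  have G: "finite G" "G \<subseteq> B" using F by (auto simp: G_def)
  have aG: "a V \<in> Hom U V" if "V \<in> G" for V using a that by (simp add: G_def)
  have FI: "V \<in> IFL" if "V \<in> F" for V using F(2) BI W that by blast
  have ac: "a V x \<in> carrier M" if "V \<in> F" "x \<in> U" for V x
    using lin_mem[OF a[OF that(1)] that(2)] submodD(1)[OF IFLD(1)[OF FI[OF that(1)]]] by blast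
  have WF: "W \<in> F"
  proof (rule ccontr)
    assume "W \<notin> F"
    then have "F \<subseteq> B" using F(2) by blast
    then show False using max_indepD(1)[OF B] U F(1) a s V0 unfolding indep_def by blast
  qed
  have split: "(\<Oplus>V\<in>F. a V x) = a W x \<oplus> (\<Oplus>V\<in>G. a V x)" if "x \<in> U" for x
  proof -
    have "F = insert W G" "W \<notin> G" using WF by (auto simp: G_def)
    then show ?thesis using G(1) ac that by (simp add: finsum_insert Pi_iff)
  qed
  have sc: "(\<Oplus>V\<in>G. a V x) \<in> carrier M" if "x \<in> U" for x
    using ac that by (intro finsum_closed) (auto simp: G_def)
  have awc: "a W x \<in> carrier M" if "x \<in> U" for x using ac WF that by blast
  \<comment> \<open>A non-isomorphic coefficient at \<open>W\<close> would itself be radical;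
    subtracting it would leave a nontrivial relation among members of \<open>B\<close>
    alone.\<close>
  have bW: "bij_betw (a W) U W"
  proof (rule ccontr)
    assume nb: "\<not> bij_betw (a W) U W"
    have "a W \<in> rad U" using nb a[OF WF] W by (auto simp: rad_def)
    then have "(\<lambda>x. \<ominus> a W x) \<in> asum U (rad U)" by (intro asum_base rad_carrier rad_neg)
    then have "(\<lambda>x. (\<ominus> a W x) \<oplus> (\<Oplus>V\<in>F. a V x)) \<in> asum U (rad U)"
      by (rule asum_plus[OF _ s rad_carrier])
    then have "(\<lambda>x. \<Oplus>V\<in>G. a V x) \<in> asum U (rad U)"
    proof (rule asum_cong)
      show "(\<Oplus>V\<in>G. a V x) = (\<ominus> a W x) \<oplus> (\<Oplus>V\<in>F. a V x)" if "x \<in> U" for x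
        unfolding split[OF that] using sc[OF that] awc[OF that] by (simp add: r_neg1)
    qed
    then have "\<forall>V\<in>G. \<not> bij_betw (a V) U V" using max_indepD(1)[OF B] U G aG unfolding indep_def by blast
    moreover have "V0 \<in> G" using V0 nb by (auto simp: G_def)
    ultimately show False using V0(2) by blast
  qed
  define c where "c = inv_into U (a W)"
  have c: "c \<in> Hom W U" unfolding c_def by (rule lin_inv[OF a[OF WF] bW IFLD(1)[OF U]])
  have cb: "bij_betw c W U" unfolding c_def by (rule bij_betw_inv_into[OF bW])
  have ac': "a W (c x) = x" if "x \<in> W" for x
    unfolding c_def using bW that by (simp add: bij_betw_def f_inv_into_f)
  \<comment> \<open>Precomposing the relation with the inverse \<open>c\<close> turns the
    coefficient at \<open>W\<close> into the identity; the remaining terms, negated, form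
    \<open>l\<close>.\<close>
  define r where "r = (\<lambda>x. \<Oplus>V\<in>F. a V x) \<circ> c"
  define l where "l = (\<lambda>x. \<ominus> (\<Oplus>V\<in>G. a V x)) \<circ> c"
  have "r \<in> asum W (rad W)"
    unfolding r_def
  proof (rule asum_bind[OF s])
    show "g \<circ> c \<in> asum W (rad W)" if "g \<in> rad U" for g
      by (rule asum_base[OF rad_comp_bij[OF that c cb] rad_carrier])
    show "c \<in> W \<rightarrow> U" using c by (simp add: lin_def)
  qed (rule rad_carrier)
  moreover have "l \<in> asum W (homs W B)"
    unfolding l_def
  proof (rule asum_homs_comp[OF _ c BI])
    have "(\<lambda>x. \<Oplus>V\<in>G. a V x) \<in> asum U (homs U B)"
    proof (rule asum_finsum[OF G(1)])
      show "a V \<in> asum U (homs U B)" if "V \<in> G" for V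
        using aG[OF that] that G(2) by (intro asum_base homs_carrier[OF BI]) (auto simp: homs_def)
    qed (rule homs_carrier[OF BI])
    then show "(\<lambda>x. \<ominus> (\<Oplus>V\<in>G. a V x)) \<in> asum U (homs U B)"
      by (rule asum_neg[OF _ homs_carrier[OF BI] homs_neg[OF BI]])
  qed
  moreover have "x = l x \<oplus> r x" if "x \<in> W" for x
  proof -
    have cx: "c x \<in> U" by (rule lin_mem[OF c that])
    have xc: "x \<in> carrier M" using submodD(1)[OF IFLD(1)[OF W] that] .
    have "l x \<oplus> r x = \<ominus> (\<Oplus>V\<in>G. a V (c x)) \<oplus> (x \<oplus> (\<Oplus>V\<in>G. a V (c x)))"
      by (simp add: l_def r_def split[OF cx] ac'[OF that])
    also have "\<dots> = x" using xc sc[OF cx] by (simp add: a_comm[of x] r_neg1)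
    finally show ?thesis by simp
  qed
  ultimately show ?thesis using that by blast
qed

text \<open>Here \<open>k\<close> counts the factors missing from \<open>N\<close>. A composite of
  \<open>N\<close> factors vanishes. For a shorter one, the identity of its target splits by
  \<open>span_mod_rad\<close>; the part through \<open>B\<close> is of the desired form, and the
  radical part yields composites with one factor more.\<close>

lemma radcomp_in_span:
  assumes B: "max_indep B" and N: "rad_nilpotent N"
  shows "k \<le> N \<Longrightarrow> radcomp (N - k) W V g \<Longrightarrow> g \<in> asum W (homs W B)"
proof (induction k arbitrary: V g)
  case 0
  then show ?case using N by (intro asum_zero) (auto simp: rad_nilpotent_def)
next
  case (Suc k)
  have BI: "B \<subseteq> IFL" by (rule max_indepD(2)[OF B])
  have k: "N - k = Suc (N - Suc k)" "k \<le> N" using Suc.prems(1) by auto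
  have g: "V \<in> IFL" "g \<in> Hom W V" using radcomp_Hom[OF Suc.prems(2)] by auto
  obtain l r where l: "l \<in> asum V (homs V B)" and r: "r \<in> asum V (rad V)"
    and lr: "\<And>x. x \<in> V \<Longrightarrow> x = l x \<oplus> r x"
    using span_mod_rad[OF B g(1)] by blast
  have "r \<circ> g \<in> asum W (homs W B)"
  proof (rule asum_bind[OF r])
    fix h assume "h \<in> rad V"
    then obtain V' where "V' \<in> IFL" "h \<in> Hom V V'" "\<not> bij_betw h V V'" by (auto simp: rad_def)
    then have "radcomp (N - k) W V' (h \<circ> g)" unfolding k(1) by (rule radcomp_Suc[OF Suc.prems(2)])
    then show "h \<circ> g \<in> asum W (homs W B)" by (rule Suc.IH[OF k(2)])
  qed (use g homs_carrier[OF BI] in \<open>auto simp: lin_def\<close>)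
  then have "(\<lambda>x. (l \<circ> g) x \<oplus> (r \<circ> g) x) \<in> asum W (homs W B)"
    by (rule asum_plus[OF asum_homs_comp[OF l g(2) BI] _ homs_carrier[OF BI]])
  then show ?case by (rule asum_cong) (use lr lin_mem[OF g(2)] in auto)
qed

text \<open>The composite of no factors is the identity of a member of \<open>IFL\<close>, so
  \<open>radcomp_in_span\<close> with \<open>k = N\<close> handles these members;
  \<open>id_in_asum_homs\<close> reduces \<open>X\<close> to them.\<close>

lemma id_in_span:
  assumes B: "max_indep B" and N: "rad_nilpotent N"
    and X: "fl R M X" "submod R M X"
  shows "(\<lambda>x. x) \<in> asum X (homs X B)"
proof -
  have BI: "B \<subseteq> IFL" by (rule max_indepD(2)[OF B])
  have "(\<lambda>x. x) \<circ> (\<lambda>x. x) \<in> asum X (homs X B)"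
  proof (rule asum_bind[OF id_in_asum_homs[OF X]])
    fix g assume "g \<in> homs X IFL"
    then obtain V where V: "V \<in> IFL" "g \<in> Hom X V" by (auto simp: homs_def)
    have "(\<lambda>x. x) \<in> asum V (homs V B)"
      using radcomp_in_span[OF B N, of N V V "\<lambda>x. x"] radcomp_0[OF V(1)] by simp
    then have "(\<lambda>x. x) \<circ> g \<in> asum X (homs X B)" using V(2) BI by (rule asum_homs_comp)
    then show "g \<circ> (\<lambda>x. x) \<in> asum X (homs X B)" by (simp add: comp_def)
  qed (use homs_carrier[OF BI] in auto)
  then show ?thesis by (simp add: comp_def)
qed

text \<open>The formula covers both cases: if \<open>W\<close> already belongs to \<open>F\<close>,
  the new term is added to the old one at \<open>W\<close>, and otherwise the old term there counts
  as zero.\<close>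

lemma finsum_add_component:
  assumes F: "finite F" and w: "w \<in> carrier M" and s: "\<And>V. V \<in> F \<Longrightarrow> s V \<in> carrier M"
  shows "w \<oplus> (\<Oplus>V\<in>F. s V) = (\<Oplus>V\<in>insert W F. (if W = V then w else \<zero>) \<oplus> (if V \<in> F then s V else \<zero>))"
proof -
  have "(\<Oplus>V\<in>insert W F. (if W = V then w else \<zero>) \<oplus> (if V \<in> F then s V else \<zero>)) =
      (\<Oplus>V\<in>insert W F. if W = V then w else \<zero>) \<oplus> (\<Oplus>V\<in>insert W F. if V \<in> F then s V else \<zero>)"
    using w s by (intro finsum_addf) auto
  also have "(\<Oplus>V\<in>insert W F. if W = V then w else \<zero>) = w"
    using F w by (intro finsum_singleton[of W "insert W F" "\<lambda>_. w"]) auto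
  also have "(\<Oplus>V\<in>insert W F. if V \<in> F then s V else \<zero>) = (\<Oplus>V\<in>F. s V)"
    using F s by (intro add.finprod_mono_neutral_cong_right) auto
  finally show ?thesis by simp
qed

text \<open>Summands with the same target are collected into one coefficient, which is the form of a
  relation used in \<open>indep\<close>.\<close>

lemma asum_homs_finsum:
  assumes "h \<in> asum X (homs X B)" and BI: "B \<subseteq> IFL"
  shows "\<exists>F s. finite F \<and> F \<subseteq> B \<and> (\<forall>V\<in>F. s V \<in> Hom X V) \<and> (\<forall>x\<in>X. h x = (\<Oplus>V\<in>F. s V x))"
  using assms(1)
proof (induction rule: asum.induct)
  case (asum_zero h)
  then show ?case by (intro exI[of _ "{}"]) auto
next
  case (asum_add g h k)
  obtain F s where F: "finite F" "F \<subseteq> B" and s: "\<And>V. V \<in> F \<Longrightarrow> s V \<in> Hom X V"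
    and h: "\<And>x. x \<in> X \<Longrightarrow> h x = (\<Oplus>V\<in>F. s V x)" using asum_add.IH by blast
  obtain W where W: "W \<in> B" "g \<in> Hom X W" using asum_add.hyps(1) by (auto simp: homs_def)
  have sub: "submod R M V" if "V \<in> B" for V using that BI IFLD(1) by blast
  define u where "u V = (\<lambda>x. (if W = V then g x else \<zero>) \<oplus> (if V \<in> F then s V x else \<zero>))" for V
  have u: "u V \<in> Hom X V" if "V \<in> insert W F" for V
  proof -
    have V: "submod R M V" using that W(1) F(2) sub by blast
    have "(\<lambda>x. if W = V then g x else \<zero>) \<in> Hom X V"
      using W(2) Hom_const_zero[OF V, of X] by (cases "W = V") simp_all
    moreover have "(\<lambda>x. if V \<in> F then s V x else \<zero>) \<in> Hom X V"
      using s[of V] Hom_const_zero[OF V, of X] by (cases "V \<in> F") simp_all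
    ultimately show ?thesis unfolding u_def by (rule Hom_plus[OF _ _ V])
  qed
  have "k x = (\<Oplus>V\<in>insert W F. u V x)" if x: "x \<in> X" for x
  proof -
    have "g x \<in> carrier M" using submodD(1)[OF sub[OF W(1)] lin_mem[OF W(2) x]] .
    moreover have "s V x \<in> carrier M" if "V \<in> F" for V
      using submodD(1)[OF sub lin_mem[OF s[OF that] x]] that F(2) by blast
    ultimately show ?thesis
      using finsum_add_component[OF F(1), of "g x" "\<lambda>V. s V x" W] asum_add.hyps(3)[OF x] h[OF x]
      by (simp add: u_def)
  qed
  then show ?case using F W u by (intro exI[of _ "insert W F"] exI[of _ u]) auto
qed

text \<open>This is the submodule generated by the images in \<open>V\<close> of all composites of
  \<open>n\<close> non-isomorphisms, a radical filtration of \<open>V\<close>.\<close>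

definition rpow :: "nat \<Rightarrow> 'a set \<Rightarrow> 'a set" where
  "rpow n V = \<Inter>{N. submod R M N \<and> (\<forall>W g. radcomp n W V g \<longrightarrow> g ` W \<subseteq> N)}"

lemma submod_rpow:
  assumes V: "V \<in> IFL"
  shows "submod R M (rpow n V)"
proof -
  have "g ` W \<subseteq> V" if "radcomp n W V g" for W g
    using radcomp_Hom[OF that] by (auto simp: lin_def)
  then have "rpow n V \<subseteq> V" unfolding rpow_def using IFLD(1)[OF V] by blast
  then have "rpow n V \<subseteq> carrier M" using submod_subset[OF IFLD(1)[OF V]] by blast
  then show ?thesis unfolding submod_def rpow_def by (auto dest: submodD(2-5))
qed

lemma rpow_0: "V \<in> IFL \<Longrightarrow> x \<in> V \<Longrightarrow> x \<in> rpow 0 V"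
  unfolding rpow_def using radcomp_0[of V] by blast

text \<open>If \<open>N\<close> contains the images of all composites with one factor more, its
  preimage under \<open>f\<close> is a submodule containing the images of all composites of
  \<open>n\<close> factors ending at \<open>V\<close>, hence contains \<open>x\<close>.\<close>

lemma rpow_Suc:
  assumes "x \<in> rpow n V" "V \<in> IFL" "x \<in> V" "V' \<in> IFL" "f \<in> Hom V V'" "\<not> bij_betw f V V'"
  shows "f x \<in> rpow (Suc n) V'"
  unfolding rpow_def
proof (intro InterI, clarify)
  fix N assume N: "submod R M N" "\<forall>W g. radcomp (Suc n) W V' g \<longrightarrow> g ` W \<subseteq> N"
  have "submod R M {y \<in> V. f y \<in> N}"
    using Hom_vimage[OF assms(5) IFLD(1)[OF assms(2)] IFLD(1)[OF assms(4)] N(1)] .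
  moreover have "g ` W \<subseteq> {y \<in> V. f y \<in> N}" if g: "radcomp n W V g" for W g
  proof -
    have "(f \<circ> g) ` W \<subseteq> N" using N(2) radcomp_Suc[OF g assms(4-6)] by blast
    moreover have "g ` W \<subseteq> V" using radcomp_Hom[OF g] by (auto simp: lin_def)
    ultimately show ?thesis by auto
  qed
  ultimately show "f x \<in> N" using assms(1) unfolding rpow_def by blast
qed

lemma rpow_zero:
  assumes "rad_nilpotent N" "x \<in> rpow N V"
  shows "x = \<zero>"
  using assms submod_zero unfolding rpow_def rad_nilpotent_def by blast

lemma fl_cover:
  assumes "finite F" "\<And>V. V \<in> F \<Longrightarrow> submod R M V \<and> fl R M V"
  shows "\<exists>X. submod R M X \<and> fl R M X \<and> (\<forall>V\<in>F. V \<subseteq> X)"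
  using assms
proof (induction F rule: finite_induct)
  case empty
  have "chain_bounded (submods R M {\<zero>}) 0"
    by (rule chain_bounded_rank[of _ "\<lambda>_. 0"]) (auto simp: submods_def dest: submodD(2))
  then show ?case using submod_zero by (auto simp: fl_def)
next
  case (insert V F)
  then obtain X where X: "submod R M X" "fl R M X" "\<forall>V\<in>F. V \<subseteq> X" by auto
  have V: "submod R M V" "fl R M V" using insert.prems by auto
  show ?case
    using fl_plus[OF V X(1,2)] submod_plus[OF V(1) X(1)] plus_upper[OF V(1) X(1)] X(3)
    by (intro exI[of _ "plus V X"]) auto
qed

lemma indep_finsum_zero:
  assumes B: "max_indep B" and N: "rad_nilpotent N"
    and F: "finite F" "F \<subseteq> B" and p: "\<And>V. V \<in> F \<Longrightarrow> p V \<in> V" and s: "finsum M p F = \<zero>"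
    and V: "V \<in> F"
  shows "p V = \<zero>"
proof -
  have BI: "B \<subseteq> IFL" by (rule max_indepD(2)[OF B])
  have I: "V \<in> IFL" if "V \<in> B" for V using that BI by blast
  have sub: "submod R M V" if "V \<in> B" for V using I[OF that] IFLD(1) by blast
  obtain X where X: "submod R M X" "fl R M X" "\<And>V. V \<in> F \<Longrightarrow> V \<subseteq> X"
  proof -
    have "submod R M V \<and> fl R M V" if "V \<in> F" for V
      using IFLD(1,2)[OF I[OF subsetD[OF F(2) that]]] by simp
    then show thesis using fl_cover[OF F(1)] that by blast
  qed
  obtain G s where G: "finite G" "G \<subseteq> B" and s': "\<And>V. V \<in> G \<Longrightarrow> s V \<in> Hom X V"
    and idX: "\<And>x. x \<in> X \<Longrightarrow> x = (\<Oplus>V\<in>G. s V x)"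
    using asum_homs_finsum[OF id_in_span[OF B N X(2,1)] BI] by blast
  \<comment> \<open>The coefficients are extended by zero so that those of the identity of
    \<open>X\<close> and the members of \<open>F\<close> share the index set
    \<open>F \<union> G\<close>.\<close>
  define t where "t V = (if V \<in> G then s V else (\<lambda>_. \<zero>))" for V
  have t: "t V \<in> Hom X V" if "V \<in> F \<union> G" for V
  proof -
    have "submod R M V" using that F(2) G(2) sub by blast
    then show ?thesis using s'[of V] Hom_const_zero[of V X] by (simp add: t_def)
  qed
  have tc: "t V x \<in> carrier M" if "V \<in> F \<union> G" "x \<in> X" for V x
    using submodD(1)[OF sub lin_mem[OF t[OF that(1)] that(2)]] that(1) F(2) G(2) by blast
  have tX: "(\<Oplus>V\<in>F \<union> G. t V x) = x" if "x \<in> X" for x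
  proof -
    have "(\<Oplus>V\<in>F \<union> G. t V x) = (\<Oplus>V\<in>G. s V x)"
      using F(1) G(1) tc[OF _ that]
      by (intro add.finprod_mono_neutral_cong_right) (auto simp: t_def)
    then show ?thesis using idX[OF that] by simp
  qed
  \<comment> \<open>Comparing \<open>t\<close> with the identity gives relations among the inclusions, so independence makes
    all entries of \<open>\<kappa>\<close> non-isomorphisms; as \<open>p = -\<kappa> p\<close>, every \<open>p V\<close> lies in all \<open>rpow n V\<close>.\<close>
  define \<kappa> where "\<kappa> c V = (\<lambda>x. t V x \<oplus> (if c = V then \<ominus> x else \<zero>))" for c V
  have \<kappa>: "\<kappa> c V \<in> Hom c V" if c: "c \<in> F" and V: "V \<in> F \<union> G" for c V
  proof -
    have VB: "submod R M V" using V F(2) G(2) sub by blast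
    have "(\<lambda>x. if c = V then \<ominus> x else \<zero>) \<in> Hom c V"
      using Hom_neg[OF id_Hom[of V V] VB] Hom_const_zero[OF VB, of c] by (cases "c = V") auto
    then show ?thesis unfolding \<kappa>_def
      using Hom_restrict[OF t[OF V] X(3)[OF c]] VB by (intro Hom_plus)
  qed
  have nonbij: "\<not> bij_betw (\<kappa> c V) c V" if c: "c \<in> F" and V: "V \<in> F \<union> G" for c V
  proof -
    \<comment> \<open>The sum is even zero: for \<open>x\<close> in \<open>c\<close> the values
      \<open>t V x\<close> add up to \<open>x\<close>, and the entry at \<open>V = c\<close>
      subtracts \<open>x\<close> once.\<close>
    have "(\<lambda>x. \<Oplus>V\<in>F \<union> G. \<kappa> c V x) \<in> asum c (rad c)"
    proof (rule asum_zero)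
      fix x assume x: "x \<in> c"
      have xX: "x \<in> X" using x X(3)[OF c] by blast
      have xc: "x \<in> carrier M" using submodD(1)[OF X(1) xX] .
      have "(\<Oplus>V\<in>F \<union> G. \<kappa> c V x) = (\<Oplus>V\<in>F \<union> G. t V x) \<oplus> (\<Oplus>V\<in>F \<union> G. if c = V then \<ominus> x else \<zero>)"
        unfolding \<kappa>_def using tc xX xc by (intro finsum_addf) auto
      also have "(\<Oplus>V\<in>F \<union> G. if c = V then \<ominus> x else \<zero>) = \<ominus> x"
        using c F(1) G(1) xc by (intro finsum_singleton[of c "F \<union> G" "\<lambda>_. \<ominus> x"]) auto
      finally show "(\<Oplus>V\<in>F \<union> G. \<kappa> c V x) = \<zero>" using tX[OF xX] xc by (simp add: r_neg)
    qed
    moreover have "\<forall>V\<in>F \<union> G. \<kappa> c V \<in> Hom c V" using \<kappa>[OF c] by blast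
    moreover have "finite (F \<union> G)" "F \<union> G \<subseteq> B" "c \<in> IFL" using F G c I by auto
    ultimately show ?thesis using max_indepD(1)[OF B] V unfolding indep_def by blast
  qed
  have pX: "p c \<in> X" if "c \<in> F" for c using p[OF that] X(3)[OF that] by blast
  have pc: "p c \<in> carrier M" if "c \<in> F" for c using submodD(1)[OF X(1) pX[OF that]] .
  \<comment> \<open>For fixed \<open>V\<close>, the terms from \<open>t\<close> add up to the value
    of \<open>t V\<close> at the sum of \<open>p\<close>, which is zero; what remains is the single
    term subtracting \<open>p V\<close>.\<close>
  have eq: "p V = \<ominus> (\<Oplus>c\<in>F. \<kappa> c V (p c))" if V: "V \<in> F" for V
  proof -
    have "(\<Oplus>c\<in>F. \<kappa> c V (p c)) = (\<Oplus>c\<in>F. t V (p c)) \<oplus> (\<Oplus>c\<in>F. if V = c then \<ominus> p c else \<zero>)"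
      unfolding \<kappa>_def using tc V pX pc by (subst finsum_addf[symmetric]) (auto intro!: finsum_cong')
    also have "(\<Oplus>c\<in>F. if V = c then \<ominus> p c else \<zero>) = \<ominus> p V"
      using V F(1) pc by (intro finsum_singleton[of V F "\<lambda>c. \<ominus> p c"]) auto
    also have "(\<Oplus>c\<in>F. t V (p c)) = t V (finsum M p F)"
      using V F by (intro Hom_finsum[symmetric, OF t X(1) sub]) (auto intro: pX)
    also have "\<dots> = \<zero>" unfolding s using V F(2) by (intro Hom_zero[OF t X(1) sub]) auto
    finally show ?thesis using pc[OF V] by simp
  qed
  have "\<forall>V\<in>F. p V \<in> rpow n V" for n
  proof (induction n)
    case 0
    then show ?case using rpow_0 p I F(2) by blast
  next
    case (Suc n)
    show ?case
    proof
      fix V assume V: "V \<in> F"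
      have VI: "V \<in> IFL" using V I F(2) by blast
      have "\<kappa> c V (p c) \<in> rpow (Suc n) V" if c: "c \<in> F" for c
        using Suc c V VI I F(2) p \<kappa> nonbij by (intro rpow_Suc[of "p c" n c]) auto
      then have "(\<Oplus>c\<in>F. \<kappa> c V (p c)) \<in> rpow (Suc n) V"
        by (intro finsum_submod[OF F(1) submod_rpow[OF VI]])
      then show "p V \<in> rpow (Suc n) V"
        using eq[OF V] submodD(4)[OF submod_rpow[OF VI]] by simp
    qed
  qed
  then show ?thesis using rpow_zero[OF N] V by blast
qed

lemma internal_dsum_if_bounded:
  assumes loc: "\<And>x. x \<in> carrier M \<Longrightarrow> \<exists>X. submod R M X \<and> fl R M X \<and> x \<in> X"
    and bd: "\<And>V. V \<in> IFL \<Longrightarrow> len R M V \<le> b"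
  shows "\<exists>B\<subseteq>IFL. internal_dsum R M B"
proof -
  obtain B where B: "max_indep B"
    using max_indep_exists by blast
  have BI: "B \<subseteq> IFL" by (rule max_indepD(2)[OF B])
  have N: "rad_nilpotent (2 ^ b - 1)"
    unfolding rad_nilpotent_def using radcomp_eventually_zero[OF bd] by blast
  have "internal_dsum R M B"
    unfolding internal_dsum_def
  proof (intro conjI ballI allI impI)
    show "submod R M V" if "V \<in> B" for V using that BI IFLD(1) by blast
    show "\<exists>F g. finite F \<and> F \<subseteq> B \<and> (\<forall>V\<in>F. g V \<in> V) \<and> x = finsum M g F" if x: "x \<in> carrier M" for x
    proof -
      obtain X where X: "submod R M X" "fl R M X" "x \<in> X" using loc[OF x] by blast
      obtain F s where "finite F" "F \<subseteq> B" "\<forall>V\<in>F. s V \<in> Hom X V" "\<forall>x\<in>X. x = (\<Oplus>V\<in>F. s V x)"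
        using asum_homs_finsum[OF id_in_span[OF B N X(2,1)] BI] by blast
      then show ?thesis using X(3) by (intro exI[of _ F] exI[of _ "\<lambda>V. s V x"]) (auto simp: lin_def)
    qed
    show "g V = \<zero>" if "finite F \<and> F \<subseteq> B \<and> (\<forall>V\<in>F. g V \<in> V) \<and> finsum M g F = \<zero>" "V \<in> F" for F g V
      using that by (intro indep_finsum_zero[OF B N, of F g V]) auto
  qed
  then show ?thesis using BI by blast
qed


subsection \<open>Passage to the subcategory\<close>

lemma finite_length_iff: "finite_length R M \<longleftrightarrow> fl R M (carrier M)"
proof -
  have "submods R M (carrier M) = Collect (submod R M)" by (auto simp: submods_def submod_def)
  then show ?thesis by (simp add: finite_length_def fl_def chain_bounded_def strict_chain_def)
qed

lemma indecomposable_iff: "indecomposable R M \<longleftrightarrow> indec (carrier M)"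
  by (auto simp: indecomposable_def indec_def plus_def)

text \<open>Among the submodules generated by finite sets, take one of maximal length. Adjoining a
  further element cannot enlarge it, so it is the whole module.\<close>

lemma fin_gen_if_fl:
  assumes "fl R M (carrier M)"
  shows "fin_gen R M"
proof -
  define gen where "gen X = \<Inter>{N. submod R M N \<and> X \<subseteq> N}" for X
  have sub: "submod R M (gen X)" if "X \<subseteq> carrier M" for X
  proof -
    have "gen X \<subseteq> carrier M" using that submod_carrier unfolding gen_def by blast
    then show ?thesis unfolding submod_def gen_def by (auto dest: submodD(2-5))
  qed
  define P where "P l \<longleftrightarrow> (\<exists>X. finite X \<and> X \<subseteq> carrier M \<and> len R M (gen X) = l)" for l
  have "P (len R M (gen {}))" unfolding P_def by blast
  moreover have "l \<le> len R M (carrier M)" if "P l" for l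
    using that len_le[OF assms sub submod_carrier submod_subset[OF sub]] unfolding P_def by blast
  ultimately obtain m where "P m" and max: "\<And>l. P l \<Longrightarrow> l \<le> m"
    using GreatestI_nat[of P] Greatest_le_nat[of P] by blast
  then obtain X where X: "finite X" "X \<subseteq> carrier M" "len R M (gen X) = m" by (auto simp: P_def)
  have "carrier M \<subseteq> gen X"
  proof
    fix x assume x: "x \<in> carrier M"
    have i: "insert x X \<subseteq> carrier M" using x X(2) by blast
    have "len R M (gen (insert x X)) \<le> m" using max X(1) i unfolding P_def by blast
    then have "gen X = gen (insert x X)"
      using len_eq[OF fl_subset[OF assms submod_subset[OF sub[OF i]]] sub[OF X(2)] sub[OF i]] X(3)
      by (auto simp: gen_def)
    then show "x \<in> gen X" by (auto simp: gen_def)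
  qed
  then show ?thesis using X(1,2) unfolding fin_gen_def gen_def by blast
qed

text \<open>The additive inverse of the restricted record is determined within the smaller carrier,
  so it first has to be identified with that of \<open>M\<close>; the other conditions use the same
  operations.\<close>

lemma submod_restrict_iff:
  assumes V: "submod R M V" and r: "rmod R (M\<lparr>carrier := V\<rparr>)"
  shows "submod R (M\<lparr>carrier := V\<rparr>) A \<longleftrightarrow> submod R M A \<and> A \<subseteq> V"
proof -
  interpret V: rmod R "M\<lparr>carrier := V\<rparr>" by fact
  have "\<ominus>\<^bsub>M\<lparr>carrier := V\<rparr>\<^esub> x = \<ominus> x" if "x \<in> V" for x
  proof -
    have "\<ominus> x \<oplus> x = \<zero>" using l_neg submodD(1)[OF V that] by blast
    then show ?thesis using V.minus_equality[of "\<ominus> x" x] submodD(4)[OF V that] that by simp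
  qed
  then show ?thesis using submodD(1)[OF V] unfolding submod_def by (auto simp: subset_iff)
qed

lemma submods_restrict:
  assumes "submod R M V" "rmod R (M\<lparr>carrier := V\<rparr>)" "X \<subseteq> V"
  shows "submods R (M\<lparr>carrier := V\<rparr>) X = submods R M X"
  using submod_restrict_iff[OF assms(1,2)] assms(3) by (auto simp: submods_def)

lemma fl_restrict:
  assumes "submod R M V" "rmod R (M\<lparr>carrier := V\<rparr>)" "X \<subseteq> V"
  shows "fl R (M\<lparr>carrier := V\<rparr>) X \<longleftrightarrow> fl R M X"
  using submods_restrict[OF assms] by (simp add: fl_def)

lemma indec_restrict:
  assumes V: "submod R M V" and r: "rmod R (M\<lparr>carrier := V\<rparr>)"
  shows "indecomposable R (M\<lparr>carrier := V\<rparr>) \<longleftrightarrow> indec V"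
proof -
  have "(submod R M A \<and> A \<subseteq> V) \<and> (submod R M B \<and> B \<subseteq> V) \<and> A \<inter> B = {\<zero>} \<and> V = plus A B \<longleftrightarrow>
      submod R M A \<and> submod R M B \<and> A \<inter> B = {\<zero>} \<and> V = plus A B" for A B
    using plus_upper[of A B] by blast
  then show ?thesis
    unfolding indecomposable_def indec_def submod_restrict_iff[OF V r] by (simp add: plus_def)
qed

section \<open>Spans of families of submodules and internal direct sums\<close>

lemma neg_zero: "\<ominus> \<zero> = \<zero>"
  by (rule minus_equality) simp_all

inductive_set dspan :: "'a set set \<Rightarrow> 'a set" for C where
  dspan_zero: "\<zero> \<in> dspan C"
| dspan_add: "V \<in> C \<Longrightarrow> v \<in> V \<Longrightarrow> x \<in> dspan C \<Longrightarrow> v \<oplus> x \<in> dspan C"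

lemma submod_dspan:
  assumes C: "\<And>V. V \<in> C \<Longrightarrow> submod R M V"
  shows "submod R M (dspan C)"
  unfolding submod_def
proof (intro conjI ballI subsetI)
  have Cc: "v \<in> carrier M" if "V \<in> C" "v \<in> V" for V v using submodD(1)[OF C[OF that(1)] that(2)] .
  show c: "x \<in> carrier M" if "x \<in> dspan C" for x
    using that by (induction rule: dspan.induct) (auto intro: Cc)
  show "\<zero> \<in> dspan C" by (rule dspan_zero)
  show "x \<oplus> y \<in> dspan C" if "x \<in> dspan C" "y \<in> dspan C" for x y
    using that(1)
  proof (induction rule: dspan.induct)
    case dspan_zero
    then show ?case using that(2) c[OF that(2)] by simp
  next
    case (dspan_add V v x)
    have "v \<oplus> (x \<oplus> y) \<in> dspan C" by (rule dspan.dspan_add[OF dspan_add.hyps(1,2) dspan_add.IH])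
    then show ?case using Cc[OF dspan_add.hyps(1,2)] c[OF dspan_add.hyps(3)] c[OF that(2)] by (simp add: a_assoc)
  qed
  show "\<ominus> x \<in> dspan C" if "x \<in> dspan C" for x
    using that
  proof (induction rule: dspan.induct)
    case dspan_zero
    then show ?case unfolding neg_zero by (rule dspan.dspan_zero)
  next
    case (dspan_add V v x)
    have "\<ominus> v \<oplus> \<ominus> x \<in> dspan C"
      by (rule dspan.dspan_add[OF dspan_add.hyps(1) submodD(4)[OF C[OF dspan_add.hyps(1)] dspan_add.hyps(2)] dspan_add.IH])
    then show ?case using Cc[OF dspan_add.hyps(1,2)] c[OF dspan_add.hyps(3)] by (simp add: minus_add)
  qed
  show "r \<odot> x \<in> dspan C" if r: "r \<in> carrier R" and "x \<in> dspan C" for r x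
    using that(2)
  proof (induction rule: dspan.induct)
    case dspan_zero
    then show ?case using dspan.dspan_zero r by (simp add: smult_zero)
  next
    case (dspan_add V v x)
    have "r \<odot> v \<oplus> r \<odot> x \<in> dspan C"
      by (rule dspan.dspan_add[OF dspan_add.hyps(1) submodD(5)[OF C[OF dspan_add.hyps(1)] r dspan_add.hyps(2)] dspan_add.IH])
    then show ?case using Cc[OF dspan_add.hyps(1,2)] c[OF dspan_add.hyps(3)] r by (simp add: smult_add)
  qed
qed

lemma dspan_upper:
  assumes C: "\<And>V. V \<in> C \<Longrightarrow> submod R M V" and V: "V \<in> C"
  shows "V \<subseteq> dspan C"
proof
  fix v assume v: "v \<in> V"
  have "v \<oplus> \<zero> \<in> dspan C" by (rule dspan_add[OF V v dspan_zero])
  then show "v \<in> dspan C" using submodD(1)[OF C[OF V] v] by simp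
qed

lemma dspan_least: "submod R M N \<Longrightarrow> (\<And>V. V \<in> C \<Longrightarrow> V \<subseteq> N) \<Longrightarrow> dspan C \<subseteq> N"
proof
  fix x assume N: "submod R M N" "\<And>V. V \<in> C \<Longrightarrow> V \<subseteq> N" and "x \<in> dspan C"
  from this(3) show "x \<in> N"
    by (induction rule: dspan.induct) (use submodD(2,3)[OF N(1)] N(2) in auto)
qed

lemma dspan_finsum:
  assumes C: "\<And>V. V \<in> C \<Longrightarrow> submod R M V" and x: "x \<in> dspan C"
  shows "\<exists>F g. finite F \<and> F \<subseteq> C \<and> (\<forall>V\<in>F. g V \<in> V) \<and> x = finsum M g F"
  using x
proof (induction rule: dspan.induct)
  case dspan_zero
  show ?case by (intro exI[of _ "{}"]) simp
next
  case (dspan_add W w x)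
  obtain F g where F: "finite F" "F \<subseteq> C" and g: "\<And>V. V \<in> F \<Longrightarrow> g V \<in> V" and x: "x = finsum M g F"
    using dspan_add.IH by blast
  have Cc: "v \<in> carrier M" if "V \<in> C" "v \<in> V" for V v using submodD(1)[OF C[OF that(1)] that(2)] .
  define u where "u V = (if W = V then w else \<zero>) \<oplus> (if V \<in> F then g V else \<zero>)" for V
  have "u V \<in> V" if "V \<in> insert W F" for V
  proof -
    have V: "submod R M V" using that F(2) dspan_add.hyps(1) C by blast
    show ?thesis unfolding u_def
      using dspan_add.hyps(2) g submodD(2)[OF V] by (intro submodD(3)[OF V]) auto
  qed
  moreover have "w \<oplus> x = finsum M u (insert W F)"
    using finsum_add_component[OF F(1), of w g W] g F(2) Cc dspan_add.hyps(1,2)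
    unfolding x u_def by blast
  ultimately show ?case using F dspan_add.hyps(1) by (intro exI[of _ "insert W F"] exI[of _ u]) auto
qed

lemma internal_dsum_submod: "internal_dsum R M B \<Longrightarrow> V \<in> B \<Longrightarrow> submod R M V"
  by (simp add: internal_dsum_def)

lemma internal_dsum_dspan:
  assumes "internal_dsum R M B"
  shows "dspan B = carrier M"
proof
  have B: "submod R M V" if "V \<in> B" for V by (rule internal_dsum_submod[OF assms that])
  show "dspan B \<subseteq> carrier M" by (rule submod_subset[OF submod_dspan[OF B]])
  show "carrier M \<subseteq> dspan B"
  proof
    fix x assume "x \<in> carrier M"
    then have "\<exists>F g. finite F \<and> F \<subseteq> B \<and> (\<forall>N\<in>F. g N \<in> N) \<and> x = finsum M g F"
      using assms by (simp add: internal_dsum_def)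
    then obtain F g where F: "finite F" "F \<subseteq> B" "\<forall>N\<in>F. g N \<in> N" "x = finsum M g F"
      by (elim exE conjE)
    have "g V \<in> dspan B" if "V \<in> F" for V
      using dspan_upper[of B V] B F(2,3) that by blast
    moreover have "submod R M (dspan B)" by (rule submod_dspan) (rule B)
    ultimately show "x \<in> dspan B" unfolding F(4) using finsum_submod[OF F(1)] by blast
  qed
qed

text \<open>An element \<open>x\<close> of the intersection is a finite sum over members of
  \<open>C\<close>; placing the negative of \<open>x\<close> at the new index \<open>V\<close> gives
  a relation with sum zero, so \<open>x\<close> vanishes.\<close>

lemma internal_dsum_Int:
  assumes "internal_dsum R M B" and V: "V \<in> B" and C: "C \<subseteq> B" "V \<notin> C"
  shows "V \<inter> dspan C = {\<zero>}"
proof -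
  have B: "submod R M V" if "V \<in> B" for V by (rule internal_dsum_submod[OF assms(1) that])
  have "x = \<zero>" if x: "x \<in> V" "x \<in> dspan C" for x
  proof -
    have "\<exists>F g. finite F \<and> F \<subseteq> C \<and> (\<forall>V\<in>F. g V \<in> V) \<and> x = finsum M g F"
      using C(1) B by (intro dspan_finsum[OF _ x(2)]) blast
    then obtain F g where F: "finite F" "F \<subseteq> C" and g: "\<And>W. W \<in> F \<Longrightarrow> g W \<in> W" and s: "x = finsum M g F"
      by blast
    have xc: "x \<in> carrier M" using submodD(1)[OF B[OF V] x(1)] .
    have gc: "g W \<in> carrier M" if "W \<in> F" for W
      using submodD(1)[OF B g[OF that]] that F(2) C(1) by blast
    define h where "h W = (if W = V then \<ominus> x else g W)" for W
    have VF: "V \<notin> F" using F(2) C(2) by blast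
    have "finsum M h (insert V F) = h V \<oplus> finsum M h F"
      using F(1) VF gc xc by (intro finsum_insert) (auto simp: h_def)
    also have "finsum M h F = finsum M g F"
      using gc VF by (intro finsum_cong') (auto simp: h_def)
    also have "h V \<oplus> finsum M g F = \<ominus> x \<oplus> x" by (simp add: h_def s)
    finally have "finsum M h (insert V F) = \<zero>" using xc by (simp add: l_neg)
    moreover have "\<forall>W\<in>insert V F. h W \<in> W"
      using g submodD(4)[OF B[OF V] x(1)] VF by (auto simp: h_def)
    moreover have "finite (insert V F)" "insert V F \<subseteq> B" using F V C(1) by auto
    moreover have "\<forall>F g. finite F \<and> F \<subseteq> B \<and> (\<forall>N\<in>F. g N \<in> N) \<and> finsum M g F = \<zero> \<longrightarrow> (\<forall>N\<in>F. g N = \<zero>)"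
      using assms(1) by (simp add: internal_dsum_def)
    ultimately have "\<forall>W\<in>insert V F. h W = \<zero>" by presburger
    then have "h V = \<zero>" by simp
    then show ?thesis using minus_minus[OF xc] neg_zero by (simp add: h_def)
  qed
  moreover have "\<zero> \<in> V" using submodD(2)[OF B[OF V]] .
  ultimately show ?thesis using dspan_zero by blast
qed

text \<open>From infinitely many nonzero summands choose a sequence; the spans of its tails descend
  strictly, since the \<open>n\<close>-th summand meets the next tail only in zero.\<close>

lemma artinian_internal_dsum_finite:
  assumes art: "artinian_module R M" and ds: "internal_dsum R M B" and nz: "\<And>V. V \<in> B \<Longrightarrow> V \<noteq> {\<zero>}"
  shows "finite B"
proof (rule ccontr)
  assume "infinite B"
  then obtain e :: "nat \<Rightarrow> 'a set" where e: "inj e" "range e \<subseteq> B"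
    using infinite_countable_subset by blast
  have B: "submod R M V" if "V \<in> B" for V by (rule internal_dsum_submod[OF ds that])
  have eB: "submod R M V" if "V \<in> e ` A" for V A using e(2) that B by blast
  define f where "f n = dspan (e ` {n..})" for n
  have sub: "submod R M (f n)" for n unfolding f_def by (rule submod_dspan[OF eB])
  have "f (Suc n) \<subset> f n" for n
  proof -
    have up: "e m \<subseteq> f n" if "n \<le> m" for m n
      unfolding f_def by (rule dspan_upper[OF eB]) (use that in auto)
    have "f (Suc n) \<subseteq> f n" unfolding f_def[of "Suc n"]
      using up by (intro dspan_least[OF sub]) (auto dest: Suc_leD)
    moreover have "e n \<inter> f (Suc n) = {\<zero>}" unfolding f_def
      using e by (intro internal_dsum_Int[OF ds]) (auto dest: injD)
    moreover have "e n \<noteq> {\<zero>}" using nz e(2) by blast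
    ultimately show ?thesis using up[of n n] by blast
  qed
  then show False using art sub unfolding artinian_module_def by blast
qed

lemma fl_if_finite_dsum:
  assumes ds: "internal_dsum R M B" and "finite B" and "\<And>V. V \<in> B \<Longrightarrow> fl R M V"
  shows "fl R M (carrier M)"
proof -
  obtain X where X: "submod R M X" "fl R M X" "\<forall>V\<in>B. V \<subseteq> X"
    using fl_cover[OF assms(2)] assms(3) internal_dsum_submod[OF ds] by blast
  have "dspan B \<subseteq> X" using X by (intro dspan_least) auto
  then show ?thesis using fl_subset[OF X(2)] internal_dsum_dspan[OF ds] by simp
qed

text \<open>Any member \<open>V\<close> of the family is complemented by the span of the others.
  Indecomposability makes this span zero, so the module equals \<open>V\<close>.\<close>

lemma fl_if_indecomposable_dsum:
  assumes ds: "internal_dsum R M B" and B: "B \<subseteq> IFL" and i: "indecomposable R M"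
  shows "finite_length R M"
proof -
  have c: "indec (carrier M)" using i indecomposable_iff by simp
  have "B \<noteq> {}"
  proof
    assume "B = {}"
    then have "carrier M \<subseteq> {\<zero>}" using internal_dsum_dspan[OF ds] dspan_least[OF submod_zero, of "{}"] by simp
    then show False using c zero_closed unfolding indec_def by blast
  qed
  then obtain V where V: "V \<in> B" by blast
  have BI: "submod R M V" if "V \<in> B" for V using that B IFLD(1) by blast
  define D where "D = dspan (B - {V})"
  have D: "submod R M D" unfolding D_def by (rule submod_dspan) (use BI in blast)
  have "W \<subseteq> plus V D" if "W \<in> B" for W
  proof (cases "W = V")
    case True then show ?thesis using plus_upper[OF BI[OF V] D] by simp
  next
    case False
    then have "W \<subseteq> D" unfolding D_def using that BI by (intro dspan_upper) auto
    then show ?thesis using plus_upper[OF BI[OF V] D] by blast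
  qed
  then have "carrier M \<subseteq> plus V D"
    using dspan_least[OF submod_plus[OF BI[OF V] D]] internal_dsum_dspan[OF ds] by blast
  then have p: "carrier M = plus V D" using submod_subset[OF submod_plus[OF BI[OF V] D]] by blast
  have "V \<inter> D = {\<zero>}" unfolding D_def by (rule internal_dsum_Int[OF ds V]) auto
  moreover have "V \<noteq> {\<zero>}" using V B IFLD(3) unfolding indec_def by blast
  ultimately have "D = {\<zero>}" using c p BI[OF V] D unfolding indec_def by blast
  then have "plus V D \<subseteq> V" using submodD(2)[OF BI[OF V]] by (intro plus_least BI V) auto
  then show ?thesis using p fl_subset[of V "carrier M"] V B IFLD(2) finite_length_iff by blast
qed

text \<open>Here \<open>T\<close> is the largest submodule of finite length. If it were proper, the
  descending chain condition would give a minimal \<open>N\<close> strictly above it. Nothing lies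
  strictly between, so \<open>N\<close> would have finite length as an extension of
  \<open>T\<close>, a contradiction.\<close>

lemma fl_if_artinian:
  assumes art: "artinian_module R M"
    and T: "submod R M T" "fl R M T" "\<And>X. submod R M X \<Longrightarrow> fl R M X \<Longrightarrow> X \<subseteq> T"
  shows "fl R M (carrier M)"
proof (rule ccontr)
  assume nf: "\<not> fl R M (carrier M)"
  define r where "r = {(A, B). submod R M A \<and> submod R M B \<and> A \<subset> B}"
  have "wf r"
    unfolding wf_iff_no_infinite_down_chain using art unfolding artinian_module_def r_def by blast
  moreover have "carrier M \<in> {N. submod R M N \<and> T \<subset> N}"
    using T(1,2) nf submod_carrier submod_subset by blast
  ultimately obtain N where N: "submod R M N" "T \<subset> N"
    and min: "\<And>C. (C, N) \<in> r \<Longrightarrow> C \<notin> {N. submod R M N \<and> T \<subset> N}"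
    by (rule wfE_min) blast
  have min': "C = T \<or> C = N" if "submod R M C" "T \<subseteq> C" "C \<subseteq> N" for C
    using min[of C] that N(1) unfolding r_def by blast
  have "chain_bounded {C. submod R M C \<and> T \<subseteq> C \<and> C \<subseteq> N} 1"
  proof (rule chain_bounded_rank[of _ "\<lambda>C. if C = T then 0 else 1"])
    show "(if X = T then 0 else 1) < (if Y = T then 0 else (1::nat))"
      if "X \<in> {C. submod R M C \<and> T \<subseteq> C \<and> C \<subseteq> N}" "Y \<in> {C. submod R M C \<and> T \<subseteq> C \<and> C \<subseteq> N}" "X \<subset> Y" for X Y
    proof -
      have "X = T" using min'[of X] that by blast
      moreover have "Y \<noteq> T" using that by blast
      ultimately show ?thesis by simp
    qed
  qed simp
  then have "fl R M N" using fl_extension[OF T(1,2) N(1)] N(2) by blast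
  then show False using T(3)[OF N(1)] N(2) by blast
qed

lemma submod_fl_part: "submod R M {x. \<exists>X. submod R M X \<and> fl R M X \<and> x \<in> X}"
    (is "submod R M ?T")
  unfolding submod_def[of R M ?T]
proof (intro conjI ballI subsetI)
  show "x \<in> carrier M" if "x \<in> ?T" for x using that by (auto dest: submodD(1))
  show "\<zero> \<in> ?T" using fl_cover[of "{}"] by (auto dest: submodD(2))
  show "x \<oplus> y \<in> ?T" if xy: "x \<in> ?T" "y \<in> ?T" for x y
  proof -
    obtain X Y where "submod R M X" "fl R M X" "x \<in> X" "submod R M Y" "fl R M Y" "y \<in> Y" using xy by blast
    then show ?thesis using fl_plus[of X Y] submod_plus[of X Y] plusI[of x X y Y] by blast
  qed
  show "\<ominus> x \<in> ?T" if "x \<in> ?T" for x using that by (auto dest: submodD(4))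
  show "r \<odot> x \<in> ?T" if "r \<in> carrier R" "x \<in> ?T" for r x using that by (auto dest: submodD(5))
qed

text \<open>The cyclic submodule generated by \<open>x\<close> is the image of the regular module
  under the action on \<open>x\<close>.\<close>

lemma fl_cyclic:
  assumes "finite_length R (regular_module R)" and x: "x \<in> carrier M"
  shows "\<exists>X. submod R M X \<and> fl R M X \<and> x \<in> X"
proof -
  interpret R: ring R by (rule ring_R)
  interpret RR: rmod R "regular_module R" by (rule rmodI[OF right_module_regular[OF ring_R]])
  define f where "f r = r \<odot> x" for r
  have f: "f \<in> lin R (regular_module R) M (carrier (regular_module R)) (carrier M)"
    by (rule linI) (use x in \<open>auto simp: f_def regular_module_def add_smult smult_assoc\<close>)
  note h = f RR.submod_carrier RR.rmod_axioms order_refl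
  have "x \<in> f ` carrier (regular_module R)"
    using one_smult[OF x] R.one_closed unfolding f_def regular_module_def by (intro image_eqI[of _ _ "\<one>\<^bsub>R\<^esub>"]) auto
  moreover have "fl R (regular_module R) (carrier (regular_module R))"
    using assms(1) RR.finite_length_iff by blast
  ultimately show ?thesis using submod_image[OF h] fl_image[OF h] by blast
qed

end

section \<open>Transport of chain conditions along module isomorphisms\<close>

lemma mod_iso_lin:
  assumes "mod_iso R M M'"
  obtains f where "f \<in> lin R M M' (carrier M) (carrier M')" "bij_betw f (carrier M) (carrier M')"
  using assms that unfolding mod_iso_def lin_def by (auto dest: bij_betwE)

lemma mod_iso_sym:
  assumes "mod_iso R M M'" "rmod R M"
  shows "mod_iso R M' M"
proof -
  obtain f where f: "f \<in> lin R M M' (carrier M) (carrier M')" "bij_betw f (carrier M) (carrier M')"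
    by (rule mod_iso_lin[OF assms(1)])
  have "inv_into (carrier M) f \<in> lin R M' M (carrier M') (carrier M)"
    by (rule lin_inv[OF f rmod.submod_carrier[OF assms(2)]])
  then show ?thesis using bij_betw_inv_into[OF f(2)] unfolding mod_iso_def lin_def by blast
qed

lemma mod_iso_chain_bounded:
  assumes "mod_iso R M M'" "rmod R M" "rmod R M'" "chain_bounded (submods R M (carrier M)) n"
  shows "chain_bounded (submods R M' (carrier M')) n"
proof -
  obtain f where f: "f \<in> lin R M M' (carrier M) (carrier M')" "bij_betw f (carrier M) (carrier M')"
    by (rule mod_iso_lin[OF assms(1)])
  show ?thesis
    using rmod.chain_bounded_image[OF assms(3) f(1) rmod.submod_carrier[OF assms(2)] assms(2) order_refl assms(4)]
      f(2) by (simp add: bij_betw_def)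
qed

lemma mod_iso_artinian:
  assumes "mod_iso R M M'" "rmod R M" "rmod R M'" "artinian_module R M"
  shows "artinian_module R M'"
  unfolding artinian_module_def
proof
  assume "\<exists>c. (\<forall>n. submod R M' (c n)) \<and> (\<forall>n. c (Suc n) \<subset> c n)"
  then obtain c :: "nat \<Rightarrow> _" where c: "\<And>n. submod R M' (c n)" "\<And>n. c (Suc n) \<subset> c n" by blast
  obtain f where f: "f \<in> lin R M M' (carrier M) (carrier M')" "bij_betw f (carrier M) (carrier M')"
    by (rule mod_iso_lin[OF assms(1)])
  define d where "d n = {x \<in> carrier M. f x \<in> c n}" for n
  have "submod R M (d n)" for n
    unfolding d_def by (rule rmod.submod_vimage[OF assms(3) f(1) rmod.submod_carrier[OF assms(2)] assms(2) order_refl c(1)])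
  moreover have "d (Suc n) \<subset> d n" for n
  proof -
    have "c n \<subseteq> f ` carrier M" using f(2) c(1)[of n] by (simp add: bij_betw_def submod_def)
    then show ?thesis using c(2)[of n] unfolding d_def by blast
  qed
  ultimately show False using assms(4) unfolding artinian_module_def by blast
qed

section \<open>Length bounds and decompositions in the subcategory\<close>

lemma good_subcat_rmod:
  assumes "good_subcat R S" "M \<in> S"
  shows "rmod R M"
proof -
  have "\<forall>M\<in>S. right_module R M" using assms(1) unfolding good_subcat_def by (elim conjE)
  then show ?thesis using assms(2) rmodI by blast
qed

lemma good_subcat_restrict:
  assumes "good_subcat R S" "M \<in> S" "submod R M N"
  shows "M\<lparr>carrier := N\<rparr> \<in> S"
proof -
  have "\<forall>M N. M \<in> S \<and> submod R M N \<longrightarrow> M\<lparr>carrier := N\<rparr> \<in> S"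
    using assms(1) unfolding good_subcat_def by (elim conjE)
  then show ?thesis using assms(2,3) by blast
qed

text \<open>For each representative \<open>U\<close>, a bound for one module of finite length
  isomorphic to \<open>U\<close> passes through \<open>U\<close> to all others; if there is no such
  module, any number will do.\<close>

lemma length_bound:
  assumes S: "good_subcat R S"
    and fin: "\<exists>\<U>. finite \<U> \<and> \<U> \<subseteq> S \<and>
           (\<forall>M\<in>S. indecomposable R M \<and> finite_length R M \<longrightarrow> (\<exists>U\<in>\<U>. mod_iso R M U))"
  obtains b where "\<And>M. M \<in> S \<Longrightarrow> indecomposable R M \<Longrightarrow> finite_length R M \<Longrightarrow>
    chain_bounded (submods R M (carrier M)) b"
proof -
  obtain \<U> where U: "finite \<U>" "\<U> \<subseteq> S"
    "\<And>M. M \<in> S \<Longrightarrow> indecomposable R M \<Longrightarrow> finite_length R M \<Longrightarrow> \<exists>U\<in>\<U>. mod_iso R M U"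
    using fin by blast
  have "\<exists>n. \<forall>M\<in>S. finite_length R M \<and> mod_iso R M U \<longrightarrow> chain_bounded (submods R M (carrier M)) n"
    if "U \<in> \<U>" for U
  proof (cases "\<exists>M0\<in>S. finite_length R M0 \<and> mod_iso R M0 U")
    case True
    then obtain M0 where M0: "M0 \<in> S" "finite_length R M0" "mod_iso R M0 U" by blast
    have rU: "rmod R U" using good_subcat_rmod[OF S] that U(2) by blast
    have r0: "rmod R M0" by (rule good_subcat_rmod[OF S M0(1)])
    obtain n where "chain_bounded (submods R M0 (carrier M0)) n"
      using M0(2) rmod.finite_length_iff[OF r0] unfolding fl_def by blast
    then have n: "chain_bounded (submods R U (carrier U)) n"
      by (rule mod_iso_chain_bounded[OF M0(3) r0 rU])
    have "chain_bounded (submods R M (carrier M)) n" if M: "M \<in> S" "mod_iso R M U" for M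
    proof -
      have r: "rmod R M" by (rule good_subcat_rmod[OF S M(1)])
      show ?thesis by (rule mod_iso_chain_bounded[OF mod_iso_sym[OF M(2) r] rU r n])
    qed
    then show ?thesis by blast
  qed blast
  then obtain n where n: "\<And>U M. U \<in> \<U> \<Longrightarrow> M \<in> S \<Longrightarrow> finite_length R M \<Longrightarrow> mod_iso R M U \<Longrightarrow>
      chain_bounded (submods R M (carrier M)) (n U)"
    by metis
  show thesis
  \<comment> \<open>The sum dominates each of the finitely many bounds and is also defined when
    there are no representatives.\<close>
  proof (rule that[of "sum n \<U>"])
    fix M assume M: "M \<in> S" "indecomposable R M" "finite_length R M"
    then obtain V where V: "V \<in> \<U>" "mod_iso R M V" using U(3) by blast
    have "n V \<le> sum n \<U>" using V(1) U(1) by (simp add: member_le_sum)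
    then show "chain_bounded (submods R M (carrier M)) (sum n \<U>)"
      using n[OF V(1) M(1,3) V(2)] unfolding chain_bounded_def by (meson le_trans)
  qed
qed

text \<open>The subcategory is closed under submodules, so every member of \<open>IFL\<close>, taken
  as a module of its own, is an object of \<open>S\<close> and inherits the bound \<open>b\<close>
  on its length.\<close>

lemma decomposition:
  assumes S: "good_subcat R S" and M: "M \<in> S"
    and b: "\<And>M. M \<in> S \<Longrightarrow> indecomposable R M \<Longrightarrow> finite_length R M \<Longrightarrow>
      chain_bounded (submods R M (carrier M)) b"
    and loc: "\<And>x. x \<in> carrier M \<Longrightarrow> \<exists>X. submod R M X \<and> fl R M X \<and> x \<in> X"
  shows "\<exists>B\<subseteq>rmod.IFL R M. internal_dsum R M B"
proof -
  interpret rmod R M by (rule good_subcat_rmod[OF S M])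
  have "len R M V \<le> b" if V: "V \<in> IFL" for V
  proof -
    let ?V = "M\<lparr>carrier := V\<rparr>"
    note sV = IFLD(1)[OF V]
    have VS: "?V \<in> S" by (rule good_subcat_restrict[OF S M sV])
    have r: "rmod R ?V" by (rule good_subcat_rmod[OF S VS])
    have "finite_length R ?V"
      using rmod.finite_length_iff[OF r] fl_restrict[OF sV r order_refl] IFLD(2)[OF V] by simp
    moreover have "indecomposable R ?V" using indec_restrict[OF sV r] IFLD(3)[OF V] by simp
    ultimately have "chain_bounded (submods R M V) b"
      using b[OF VS] submods_restrict[OF sV r order_refl] by simp
    then show ?thesis unfolding len_def using sV by (intro height_le) (auto simp: submods_def)
  qed
  then show ?thesis using internal_dsum_if_bounded loc by blast
qed

text \<open>The argument runs in the copy \<open>M0\<close>, because objects of \<open>S\<close>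
  live on the type \<open>'a\<close> and the regular module on \<open>'r\<close>; the length bound
  is carried back along the isomorphism at the end.\<close>

lemma regular_finite_length:
  assumes art: "right_artinian_ring R" and S: "good_subcat R S"
    and M0: "M0 \<in> S" "mod_iso R (regular_module R) M0"
    and b: "\<And>M. M \<in> S \<Longrightarrow> indecomposable R M \<Longrightarrow> finite_length R M \<Longrightarrow>
      chain_bounded (submods R M (carrier M)) b"
  shows "finite_length R (regular_module R)"
proof -
  interpret M0: rmod R M0 by (rule good_subcat_rmod[OF S M0(1)])
  have rR: "rmod R (regular_module R)" by (rule rmodI[OF right_module_regular[OF M0.ring_R]])
  have art0: "artinian_module R M0"
    using mod_iso_artinian[OF M0(2) rR M0.rmod_axioms] art unfolding right_artinian_ring_def by blast
  define T where "T = {x. \<exists>X. submod R M0 X \<and> fl R M0 X \<and> x \<in> X}"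
  have sT: "submod R M0 T" unfolding T_def by (rule M0.submod_fl_part)
  let ?T = "M0\<lparr>carrier := T\<rparr>"
  have TS: "?T \<in> S" by (rule good_subcat_restrict[OF S M0(1) sT])
  interpret T: rmod R ?T by (rule good_subcat_rmod[OF S TS])
  note sub = M0.submod_restrict_iff[OF sT T.rmod_axioms]
  have "\<exists>X. submod R ?T X \<and> fl R ?T X \<and> x \<in> X" if "x \<in> carrier ?T" for x
  proof -
    obtain X where X: "submod R M0 X" "fl R M0 X" "x \<in> X" using \<open>x \<in> carrier ?T\<close> by (auto simp: T_def)
    then have "X \<subseteq> T" unfolding T_def by blast
    then show ?thesis using X sub M0.fl_restrict[OF sT T.rmod_axioms] by blast
  qed
  then obtain B where B: "B \<subseteq> T.IFL" "internal_dsum R ?T B" using decomposition[OF S TS b] by blast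
  have "artinian_module R ?T" using art0 unfolding artinian_module_def sub by blast
  then have "finite B"
    by (rule T.artinian_internal_dsum_finite[OF _ B(2)]) (use B(1) T.IFLD(3) in \<open>auto simp: T.indec_def\<close>)
  then have "fl R ?T (carrier ?T)"
    by (rule T.fl_if_finite_dsum[OF B(2)]) (use B(1) T.IFLD(2) in blast)
  then have flT: "fl R M0 T" using M0.fl_restrict[OF sT T.rmod_axioms order_refl] by simp
  have "fl R M0 (carrier M0)"
    by (rule M0.fl_if_artinian[OF art0 sT flT]) (auto simp: T_def)
  then obtain n where "chain_bounded (submods R M0 (carrier M0)) n" unfolding fl_def by blast
  then have "chain_bounded (submods R (regular_module R) (carrier (regular_module R))) n"
    by (rule mod_iso_chain_bounded[OF mod_iso_sym[OF M0(2) rR] M0.rmod_axioms rR])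
  then show ?thesis using rmod.finite_length_iff[OF rR] unfolding fl_def by blast
qed

theorem theorem1:
  fixes R :: "('r, 'c) ring_scheme" and S :: "('r, 'a) module set"
  assumes "right_artinian_ring R"
    and "good_subcat R S"
    and "\<exists>M\<in>S. mod_iso R (regular_module R) M"
    and "\<exists>\<U>. finite \<U> \<and> \<U> \<subseteq> S \<and>
           (\<forall>M\<in>S. indecomposable R M \<and> finite_length R M \<longrightarrow> (\<exists>U\<in>\<U>. mod_iso R M U))"
  shows "\<forall>M\<in>S.
           (\<exists>\<N>. internal_dsum R M \<N> \<and>
              (\<forall>N\<in>\<N>. fin_gen R (M\<lparr>carrier := N\<rparr>) \<and> indecomposable R (M\<lparr>carrier := N\<rparr>))) \<and>
           (indecomposable R M \<longrightarrow> finite_length R M)"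
proof
  fix M assume M: "M \<in> S"
  note S = assms(2)
  obtain b where b: "\<And>M. M \<in> S \<Longrightarrow> indecomposable R M \<Longrightarrow> finite_length R M \<Longrightarrow>
      chain_bounded (submods R M (carrier M)) b"
    using length_bound[OF S assms(4)] by blast
  \<comment> \<open>Finite length of the regular module makes cyclic submodules have finite length,
    so each element of \<open>M\<close> satisfies the local condition of
    \<open>decomposition\<close>.\<close>
  have flR: "finite_length R (regular_module R)"
    using regular_finite_length[OF assms(1) S _ _ b] assms(3) by blast
  interpret rmod R M by (rule good_subcat_rmod[OF S M])
  obtain B where B: "B \<subseteq> IFL" "internal_dsum R M B"
    using decomposition[OF S M b fl_cyclic[OF flR]] by blast
  have "fin_gen R (M\<lparr>carrier := V\<rparr>) \<and> indecomposable R (M\<lparr>carrier := V\<rparr>)" if "V \<in> B" for V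
  proof -
    have V: "submod R M V" "fl R M V" "indec V" using that B(1) by (auto dest: IFLD)
    have r: "rmod R (M\<lparr>carrier := V\<rparr>)"
      by (rule good_subcat_rmod[OF S good_subcat_restrict[OF S M V(1)]])
    show ?thesis
      using rmod.fin_gen_if_fl[OF r] fl_restrict[OF V(1) r order_refl] indec_restrict[OF V(1) r] V(2,3)
      by simp
  qed
  then show "(\<exists>\<N>. internal_dsum R M \<N> \<and>
      (\<forall>N\<in>\<N>. fin_gen R (M\<lparr>carrier := N\<rparr>) \<and> indecomposable R (M\<lparr>carrier := N\<rparr>))) \<and>
      (indecomposable R M \<longrightarrow> finite_length R M)"
    using B(2) fl_if_indecomposable_dsum[OF B(2,1)] by blast
qed

end
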